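(* Fix $L\ge 0$ and a set $\tilde\Omega$ with $\Omega^L\subseteq\tilde\Omega\subseteq C([0,T],H)$. Let $u$ be a minimax $L$-subsolution and let $v$ be a minimax $L$-supersolution of (TVP) on $[0,T]\times\tilde\Omega$. Then $w$ defined by $w(t,x,y):=u(t,x)-v(t,y)$ is a viscosity $L$-subsolution of the doubled equation $$\partial_t w(t,x,y)-\langle A(t,x(t)),\partial_x w(t,x,y)\rangle-\langle A(t,y(t)),\partial_y w(t,x,y)\rangle+F(t,x,\partial_x w(t,x,y))-F(t,y,-\partial_y w(t,x,y))=0$$ on $[0,T]\times\tilde\Omega\times\tilde\Omega$.
   Context: Spaces. Let $T>0$. $H$ is a real Hilbert space with inner product $(\cdot,\cdot)$ and norm $|\cdot|$; $V$ is a separable reflexive Banach space with norm $\|\cdot\|$, continuously, densely and compactly embedded into $H$; $V^\ast$ is its dual with norm $\|\cdot\|_\ast$ and duality pairing $\langle x^\ast,x\rangle=x^\ast(x)$. With the usual identifications, $V\subseteq H\subseteq V^\ast$ and $\langle x,y\rangle=(x,y)$ for $x\in H$, $y\in V$. Fix $p\ge 2$, $q>1$ with $1/p+1/q=1$. For $t_0\in[0,T)$, $W_{pq}(t_0,T)$ is the space of all $\mathbf{x}\in L^p(t_0,T;V)$ possessing a generalized derivative $\mathbf{x}'\in L^q(t_0,T;V^\ast)$. Operator. $A:[0,T]\times V\to V^\ast$ is fixed and satisfies: (i) $t\mapsto\langle A(t,x),v\rangle$ is measurable for all $x,v\in V$; (ii) for a.e. $t$ and all $x,y\in V$, $\langle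 A(t,x)-A(t,y),x-y\rangle\ge 0$; (iii) for a.e. $t$ and all $x,y,v\in V$, $s\mapsto\langle A(t,x+sy),v\rangle$ is continuous on $[0,1]$; (iv) there are $a_1\in L^q(0,T)$, $c_1\ge0$ with $\|A(t,x)\|_\ast\le a_1(t)+c_1\|x\|^{p-1}$ for all $x\in V$ and a.e. $t$; (v) there is $c_2>0$ with $\langle A(t,x),x\rangle\ge c_2\|x\|^p$ for all $x\in V$ and a.e. $t$. Paths and continuity. $C([0,T],H)$ carries the sup norm. On $[0,T]\times C([0,T],H)$ and its subsets use the pseudo-metric $\mathbf{d}_\infty((t,x),(s,y))=|t-s|+\sup_{r\in[0,T]}|x(r\wedge t)-y(r\wedge s)|$, and on $[0,T]\times C([0,T],H)^2$ the analogous pseudo-metric with the pair of stopped paths; (semi-)continuity in $(t,x)$ or $(t,x,y)$ is meant with respect to these (so such functions are non-anticipating, i.e. their value at time $t$ depends only on the paths up to time $t$). USC and LSC denote real-valued upper and lower semicontinuous functions. Trajectories. For $L\ge 0$ and $(t_0,x_0)\in[0,T)\times C([0,T],H)$, $\mathcal{X}^L(t_0,x_0)$ is the set of all $x\in C([0,T],H)$ with $x=x_0$ on $[0,t_0]$ for which there exist $\mathbf{x}\in W_{pq}(t_0,T)$ and $f^x\in L^2(t_0,T;H)$ with $x=\mathbf{x}$ a.e. on $(t_0,T)$, $\mathbf{x}'(t)+A(t,\mathbf{x}(t))=f^x(t)$ a.e. on $(t_0,T)$, and $|f^x(t)|\le L(1+\sup_{0\le s\le t}|x(s)|)$ a.e.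 on $(t_0,T)$ ($\mathbf{x}$, $f^x$ are uniquely determined by $x$). Fix $x_\ast\in H$, regarded as a constant path, and put $\Omega^L:=\mathcal{X}^L(0,x_\ast)$. Data. $h:C([0,T],H)\to\mathbb{R}$ is continuous. $F:[0,T]\times C([0,T],H)\times H\to\mathbb{R}$ satisfies: (i) $F$ is continuous; (ii) there is $L_0\ge0$ with $|F(t,x,z)-F(t,x,\tilde z)|\le L_0(1+\sup_{0\le s\le t}|x(s)|)|z-\tilde z|$ for all $t,x,z,\tilde z$; (iii) for every $L\ge0$ and $(t_0,x_0)\in[0,T)\times C([0,T],H)$ there is a modulus of continuity $m_{L,t_0,x_0}$ such that for all $\varepsilon>0$, $t\in[t_0,T]$, $x,y\in\mathcal{X}^L(t_0,x_0)$: $F(t,x,\varepsilon^{-1}[x(t)-y(t)])-F(t,y,\varepsilon^{-1}[x(t)-y(t)])\le m_{L,t_0,x_0}(\varepsilon^{-1}|x(t)-y(t)|^2+\sup_{s\le t}|x(s)-y(s)|)$. (TVP) denotes the terminal-value problem $\partial_tu-\langle A(t,x(t)),\partial_xu\rangle+F(t,x,\partial_xu)=0$ on $[0,T)\times C([0,T],H)$, $u(T,x)=h(x)$. Minimax semisolutions. $u:[0,T]\times\tilde\Omega\to\mathbb{R}$ is a minimax $L$-subsolution (resp. $L$-supersolution) of (TVP) on $[0,T]\times\tilde\Omega$ if $u\in\mathrm{USC}([0,T]\times\tilde\Omega)$ (resp. $\mathrm{LSC}$), $u(T,\cdot)\le h$ (resp. $\ge h$) on $\tilde\Omega$, and for every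 $(t_0,x_0,z)\in[0,T)\times\tilde\Omega\times H$ there is $x\in\mathcal{X}^L(t_0,x_0)\cap\tilde\Omega$ such that for every $t\in[t_0,T]$: $u(t_0,x_0)\le$ (resp. $\ge$) $\int_{t_0}^t[(-f^x(s),z)+F(s,x,z)]\,ds+u(t,x)$. Test functions. For $t_\ast\in[0,T)$, $\mathcal{C}^{1,1}_V([t_\ast,T]\times C([0,T],H)^2)$ is the set of continuous $\varphi:[t_\ast,T]\times C([0,T],H)^2\to\mathbb{R}$ for which there exist continuous functions (path derivatives) $\partial_t\varphi$ (real-valued) and $\partial_x\varphi,\partial_y\varphi$ ($H$-valued) on the same domain such that: (a) for every pair $(x,y)$, $x(t)\in V$ implies $\partial_x\varphi(t,x,y)\in V$, and $y(t)\in V$ implies $\partial_y\varphi(t,x,y)\in V$, for a.e. $t\in(t_\ast,T)$; (b) for every $t_0\in[t_\ast,T)$, $x_0,y_0,x,y\in C([0,T],H)$ and $\mathbf{x},\mathbf{y}\in W_{pq}(t_0,T)$ with $x=x_0$, $y=y_0$ on $[0,t_0]$ and $x=\mathbf{x}$, $y=\mathbf{y}$ a.e. on $(t_0,T)$, and every $t\in[t_0,T]$, $\varphi(t,x,y)-\varphi(t_0,x_0,y_0)=\int_{t_0}^t\partial_t\varphi(s,x,y)+\langle\mathbf{x}'(s),\partial_x\varphi(s,x,y)\rangle+\langle\mathbf{y}'(s),\partial_y\varphi(s,x,y)\rangle\,ds$. Viscosity subsolution. For a non-anticipating $w:[0,T]\times\tilde\Omega\times\tilde\Omega\to\mathbb{R}$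 and $(t_0,x_0,y_0)\in[0,T)\times\tilde\Omega\times\tilde\Omega$, let $\underline{\mathcal{A}}^Lw(t_0,x_0,y_0)$ be the set of $\varphi\in\mathcal{C}^{1,1}_V([t_0,T]\times C([0,T],H)^2)$ for which there is $T_0\in(t_0,T]$ with $0=(\varphi-w)(t_0,x_0,y_0)=\inf(\varphi-w)$, the infimum being over $(t,x,y)\in[t_0,T_0]\times\mathcal{X}^L(t_0,x_0)\times\mathcal{X}^L(t_0,y_0)$. A function $w\in\mathrm{USC}([0,T]\times\tilde\Omega\times\tilde\Omega)$ is a viscosity $L$-subsolution of the doubled equation on $[0,T]\times\tilde\Omega\times\tilde\Omega$ if for every $(t_0,x_0,y_0)\in[0,T)\times\tilde\Omega\times\tilde\Omega$ and every $\varphi\in\underline{\mathcal{A}}^Lw(t_0,x_0,y_0)$ there is $(x,y)\in\mathcal{X}^L(t_0,x_0)\times\mathcal{X}^L(t_0,y_0)$ with $$\partial_t\varphi(t_0,x_0,y_0)+\limsup_{\delta\downarrow0}\frac1\delta\int_{t_0}^{t_0+\delta}\left[-\langle A(t,\mathbf{x}(t)),\partial_x\varphi(t,x,y)\rangle-\langle A(t,\mathbf{y}(t)),\partial_y\varphi(t,x,y)\rangle\right]dt+F(t_0,x_0,\partial_x\varphi(t_0,x_0,y_0))-F(t_0,y_0,-\partial_y\varphi(t_0,x_0,y_0))\ge0.$$ *)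

theory Defs
  imports "HOL-Analysis.Analysis"
begin

section \<open>Function spaces\<close>

text \<open>The space V is modelled by a type with an injective embedding \<open>emb\<close> into the Hilbert
  space H. Its dual is the type of bounded linear functionals on V, with the operator norm.\<close>

definition gelfand_embedding :: "('v::banach \<Rightarrow>\<^sub>L 'h::{real_inner,complete_space}) \<Rightarrow> bool" where
  "gelfand_embedding emb \<longleftrightarrow>
     (\<exists>D::'v set. countable D \<and> closure D = UNIV) \<and>
     (\<forall>\<xi>::('v \<Rightarrow>\<^sub>L real) \<Rightarrow>\<^sub>L real. \<exists>v. \<forall>g. blinfun_apply \<xi> g = blinfun_apply g v) \<and>
     inj (blinfun_apply emb) \<and>
     closure (range (blinfun_apply emb)) = UNIV \<and>
     (\<forall>B. bounded B \<longrightarrow> compact (closure (blinfun_apply emb ` B)))"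

definition H_to_dual ::
  "('v::banach \<Rightarrow>\<^sub>L 'h::{real_inner,complete_space}) \<Rightarrow> 'h \<Rightarrow> ('v \<Rightarrow>\<^sub>L real)" where
  "H_to_dual emb h = blinfun_inner_left h o\<^sub>L emb"

text \<open>The duality pairing of a functional with an element \<open>h\<close> of H that lies in V. The value is
  meaningless if \<open>h\<close> is not in the range of \<open>emb\<close>; below this happens only on null sets of times.\<close>

definition dual_pairing ::
  "('v::banach \<Rightarrow>\<^sub>L 'h::{real_inner,complete_space}) \<Rightarrow> ('v \<Rightarrow>\<^sub>L real) \<Rightarrow> 'h \<Rightarrow> real" where
  "dual_pairing emb \<xi> h = blinfun_apply \<xi> (inv (blinfun_apply emb) h)"

text \<open>Strong (Bochner) measurability. The library's Bochner theory needs the class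
  \<open>second_countable_topology\<close>, which the type of functionals on V does not have.\<close>

definition strongly_measurable_on :: "real set \<Rightarrow> (real \<Rightarrow> 'b::real_normed_vector) \<Rightarrow> bool" where
  "strongly_measurable_on S f \<longleftrightarrow>
     (\<exists>s::nat \<Rightarrow> real \<Rightarrow> 'b. (\<forall>n. simple_function (lebesgue_on S) (s n)) \<and>
        (AE t in lebesgue_on S. (\<lambda>n. s n t) \<longlonglongrightarrow> f t))"

text \<open>Elements of Lebesgue spaces are represented by functions, not by equivalence classes.\<close>

definition Lp_on :: "real \<Rightarrow> real \<Rightarrow> real \<Rightarrow> (real \<Rightarrow> 'b::real_normed_vector) \<Rightarrow> bool" where
  "Lp_on r a b f \<longleftrightarrow>
     strongly_measurable_on {a..b} f \<and> integrable (lebesgue_on {a..b}) (\<lambda>t. norm (f t) powr r)"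

definition smooth_compact_support :: "real \<Rightarrow> real \<Rightarrow> (real \<Rightarrow> real) \<Rightarrow> bool" where
  "smooth_compact_support a b \<psi> \<longleftrightarrow>
     (\<forall>n t. ((deriv ^^ n) \<psi>) differentiable (at t)) \<and>
     (\<exists>c d. a < c \<and> d < b \<and> (\<forall>t. t \<notin> {c..d} \<longrightarrow> \<psi> t = 0))"

text \<open>\<open>W_pq emb p q a b X X'\<close>: X belongs to the space W and has the generalized derivative X'. The
  defining identity of integrals in the dual of V is written out by evaluating both sides
  at each element \<open>v\<close> of V.\<close>

definition W_pq ::
  "('v::banach \<Rightarrow>\<^sub>L 'h::{real_inner,complete_space}) \<Rightarrow> real \<Rightarrow> real \<Rightarrow> real \<Rightarrow> real \<Rightarrow>
   (real \<Rightarrow> 'v) \<Rightarrow> (real \<Rightarrow> ('v \<Rightarrow>\<^sub>L real)) \<Rightarrow> bool" where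
  "W_pq emb p q a b X X' \<longleftrightarrow>
     Lp_on p a b X \<and> Lp_on q a b X' \<and>
     (\<forall>\<psi>. smooth_compact_support a b \<psi> \<longrightarrow>
        (\<forall>v. integral\<^sup>L (lebesgue_on {a..b})
               (\<lambda>t. deriv \<psi> t * blinfun_apply (H_to_dual emb (blinfun_apply emb (X t))) v)
           = - integral\<^sup>L (lebesgue_on {a..b}) (\<lambda>t. \<psi> t * blinfun_apply (X' t) v)))"

definition operator_assms ::
  "real \<Rightarrow> real \<Rightarrow> real \<Rightarrow> (real \<Rightarrow> 'v::banach \<Rightarrow> ('v \<Rightarrow>\<^sub>L real)) \<Rightarrow> bool" where
  "operator_assms T p q A \<longleftrightarrow>
     (\<forall>x v. (\<lambda>t. blinfun_apply (A t x) v) \<in> borel_measurable (lebesgue_on {0..T})) \<and>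
     (AE t in lebesgue_on {0..T}. \<forall>x y. blinfun_apply (A t x - A t y) (x - y) \<ge> 0) \<and>
     (AE t in lebesgue_on {0..T}. \<forall>x y v.
        continuous_on {0..1} (\<lambda>s::real. blinfun_apply (A t (x + s *\<^sub>R y)) v)) \<and>
     (\<exists>a\<^sub>1::real \<Rightarrow> real. \<exists>c\<^sub>1\<ge>0. Lp_on q 0 T a\<^sub>1 \<and>
        (AE t in lebesgue_on {0..T}. \<forall>x. norm (A t x) \<le> a\<^sub>1 t + c\<^sub>1 * norm x powr (p - 1))) \<and>
     (\<exists>c\<^sub>2>0. AE t in lebesgue_on {0..T}. \<forall>x. blinfun_apply (A t x) x \<ge> c\<^sub>2 * norm x powr p)"

section \<open>Paths and (semi-)continuity\<close>

text \<open>Paths are undefined outside \<open>{0..T}\<close>, so that equality of functions is equality of paths.\<close>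

definition paths :: "real \<Rightarrow> (real \<Rightarrow> 'h::real_normed_vector) set" where
  "paths T = {x. x \<in> extensional {0..T} \<and> continuous_on {0..T} x}"

definition const_path :: "real \<Rightarrow> 'h \<Rightarrow> real \<Rightarrow> 'h" where
  "const_path T a = restrict (\<lambda>_. a) {0..T}"

definition sup_dist ::
  "real \<Rightarrow> (real \<Rightarrow> 'h::real_normed_vector) \<Rightarrow> (real \<Rightarrow> 'h) \<Rightarrow> real" where
  "sup_dist T x y = (SUP r\<in>{0..T}. norm (x r - y r))"

definition sup_upto :: "real \<Rightarrow> (real \<Rightarrow> 'h::real_normed_vector) \<Rightarrow> real" where
  "sup_upto t x = (SUP s\<in>{0..t}. norm (x s))"

definition d_inf ::
  "real \<Rightarrow> real \<times> (real \<Rightarrow> 'h::real_normed_vector) \<Rightarrow> real \<times> (real \<Rightarrow> 'h) \<Rightarrow> real" where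
  "d_inf T = (\<lambda>(t, x) (s, y).
     \<bar>t - s\<bar> + (SUP r\<in>{0..T}. norm (x (min r t) - y (min r s))))"

definition d_inf2 ::
  "real \<Rightarrow> real \<times> (real \<Rightarrow> 'h::real_normed_vector) \<times> (real \<Rightarrow> 'h) \<Rightarrow>
   real \<times> (real \<Rightarrow> 'h) \<times> (real \<Rightarrow> 'h) \<Rightarrow> real" where
  "d_inf2 T = (\<lambda>(t, x, y) (s, x', y').
     \<bar>t - s\<bar> + (SUP r\<in>{0..T}.
        norm ((x (min r t), y (min r t)) - (x' (min r s), y' (min r s)))))"

text \<open>(Semi-)continuity of the restriction to \<open>S\<close> with respect to a pseudo-metric. The library's
  notions need a genuine metric.\<close>

definition cont_wrt :: "('a \<Rightarrow> 'a \<Rightarrow> real) \<Rightarrow> 'a set \<Rightarrow> ('a \<Rightarrow> 'b::metric_space) \<Rightarrow> bool" where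
  "cont_wrt d S f \<longleftrightarrow>
     (\<forall>a\<in>S. \<forall>e>0. \<exists>\<delta>>0. \<forall>b\<in>S. d a b < \<delta> \<longrightarrow> dist (f b) (f a) < e)"

definition usc_wrt :: "('a \<Rightarrow> 'a \<Rightarrow> real) \<Rightarrow> 'a set \<Rightarrow> ('a \<Rightarrow> real) \<Rightarrow> bool" where
  "usc_wrt d S f \<longleftrightarrow> (\<forall>a\<in>S. \<forall>e>0. \<exists>\<delta>>0. \<forall>b\<in>S. d a b < \<delta> \<longrightarrow> f b < f a + e)"

definition lsc_wrt :: "('a \<Rightarrow> 'a \<Rightarrow> real) \<Rightarrow> 'a set \<Rightarrow> ('a \<Rightarrow> real) \<Rightarrow> bool" where
  "lsc_wrt d S f \<longleftrightarrow> (\<forall>a\<in>S. \<forall>e>0. \<exists>\<delta>>0. \<forall>b\<in>S. d a b < \<delta> \<longrightarrow> f a - e < f b)"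

section \<open>Trajectories\<close>

text \<open>\<open>X\<close> is the V-valued version of \<open>x\<close>, and \<open>f\<close> is the right-hand side. Both are determined by \<open>x\<close>
  up to null sets, so the definitions below may refer to any such pair.\<close>

definition trajectory ::
  "('v::banach \<Rightarrow>\<^sub>L 'h::{real_inner,complete_space}) \<Rightarrow> (real \<Rightarrow> 'v \<Rightarrow> ('v \<Rightarrow>\<^sub>L real)) \<Rightarrow>
   real \<Rightarrow> real \<Rightarrow> real \<Rightarrow> real \<Rightarrow> real \<Rightarrow> (real \<Rightarrow> 'h) \<Rightarrow>
   (real \<Rightarrow> 'h) \<Rightarrow> (real \<Rightarrow> 'v) \<Rightarrow> (real \<Rightarrow> 'h) \<Rightarrow> bool" where
  "trajectory emb A T p q L t\<^sub>0 x\<^sub>0 x X f \<longleftrightarrow>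
     x \<in> paths T \<and> (\<forall>t\<in>{0..t\<^sub>0}. x t = x\<^sub>0 t) \<and>
     Lp_on 2 t\<^sub>0 T f \<and>
     (AE t in lebesgue_on {t\<^sub>0..T}. x t = blinfun_apply emb (X t)) \<and>
     (\<exists>X'. W_pq emb p q t\<^sub>0 T X X' \<and>
        (AE t in lebesgue_on {t\<^sub>0..T}. X' t + A t (X t) = H_to_dual emb (f t))) \<and>
     (AE t in lebesgue_on {t\<^sub>0..T}. norm (f t) \<le> L * (1 + sup_upto t x))"

definition trajectories ::
  "('v::banach \<Rightarrow>\<^sub>L 'h::{real_inner,complete_space}) \<Rightarrow> (real \<Rightarrow> 'v \<Rightarrow> ('v \<Rightarrow>\<^sub>L real)) \<Rightarrow>
   real \<Rightarrow> real \<Rightarrow> real \<Rightarrow> real \<Rightarrow> real \<Rightarrow> (real \<Rightarrow> 'h) \<Rightarrow> (real \<Rightarrow> 'h) set" where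
  "trajectories emb A T p q L t\<^sub>0 x\<^sub>0 = {x. \<exists>X f. trajectory emb A T p q L t\<^sub>0 x\<^sub>0 x X f}"

section \<open>Hamiltonian and minimax semisolutions\<close>

definition modulus_of_continuity :: "(real \<Rightarrow> real) \<Rightarrow> bool" where
  "modulus_of_continuity m \<longleftrightarrow>
     m 0 = 0 \<and> mono_on {0..} m \<and> continuous (at 0 within {0..}) m"

definition hamiltonian_assms ::
  "('v::banach \<Rightarrow>\<^sub>L 'h::{real_inner,complete_space}) \<Rightarrow> (real \<Rightarrow> 'v \<Rightarrow> ('v \<Rightarrow>\<^sub>L real)) \<Rightarrow>
   real \<Rightarrow> real \<Rightarrow> real \<Rightarrow> (real \<Rightarrow> (real \<Rightarrow> 'h) \<Rightarrow> 'h \<Rightarrow> real) \<Rightarrow> bool" where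
  "hamiltonian_assms emb A T p q F \<longleftrightarrow>
     cont_wrt (\<lambda>(t, x, z) (s, y, z'). d_inf T (t, x) (s, y) + norm (z - z'))
       ({0..T} \<times> paths T \<times> UNIV) (\<lambda>(t, x, z). F t x z) \<and>
     (\<exists>L\<^sub>0\<ge>0. \<forall>t\<in>{0..T}. \<forall>x\<in>paths T. \<forall>z z'.
        \<bar>F t x z - F t x z'\<bar> \<le> L\<^sub>0 * (1 + sup_upto t x) * norm (z - z')) \<and>
     (\<forall>L\<ge>0. \<forall>t\<^sub>0\<in>{0..<T}. \<forall>x\<^sub>0\<in>paths T. \<exists>m. modulus_of_continuity m \<and>
        (\<forall>\<epsilon>>0. \<forall>t\<in>{t\<^sub>0..T}. \<forall>x\<in>trajectories emb A T p q L t\<^sub>0 x\<^sub>0.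
           \<forall>y\<in>trajectories emb A T p q L t\<^sub>0 x\<^sub>0.
             F t x ((x t - y t) /\<^sub>R \<epsilon>) - F t y ((x t - y t) /\<^sub>R \<epsilon>)
             \<le> m ((norm (x t - y t))\<^sup>2 / \<epsilon> + sup_upto t (\<lambda>s. x s - y s))))"

definition minimax_subsolution ::
  "('v::banach \<Rightarrow>\<^sub>L 'h::{real_inner,complete_space}) \<Rightarrow> (real \<Rightarrow> 'v \<Rightarrow> ('v \<Rightarrow>\<^sub>L real)) \<Rightarrow>
   real \<Rightarrow> real \<Rightarrow> real \<Rightarrow> (real \<Rightarrow> (real \<Rightarrow> 'h) \<Rightarrow> 'h \<Rightarrow> real) \<Rightarrow> ((real \<Rightarrow> 'h) \<Rightarrow> real) \<Rightarrow>
   real \<Rightarrow> (real \<Rightarrow> 'h) set \<Rightarrow> (real \<Rightarrow> (real \<Rightarrow> 'h) \<Rightarrow> real) \<Rightarrow> bool" where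
  "minimax_subsolution emb A T p q F h L \<Omega> u \<longleftrightarrow>
     usc_wrt (d_inf T) ({0..T} \<times> \<Omega>) (\<lambda>(t, x). u t x) \<and>
     (\<forall>x\<in>\<Omega>. u T x \<le> h x) \<and>
     (\<forall>t\<^sub>0\<in>{0..<T}. \<forall>x\<^sub>0\<in>\<Omega>. \<forall>z. \<exists>x\<in>\<Omega>. \<exists>X f. trajectory emb A T p q L t\<^sub>0 x\<^sub>0 x X f \<and>
        (\<forall>t\<in>{t\<^sub>0..T}. u t\<^sub>0 x\<^sub>0 \<le>
           integral\<^sup>L (lebesgue_on {t\<^sub>0..t}) (\<lambda>s. (- f s) \<bullet> z + F s x z) + u t x))"

definition minimax_supersolution ::
  "('v::banach \<Rightarrow>\<^sub>L 'h::{real_inner,complete_space}) \<Rightarrow> (real \<Rightarrow> 'v \<Rightarrow> ('v \<Rightarrow>\<^sub>L real)) \<Rightarrow>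
   real \<Rightarrow> real \<Rightarrow> real \<Rightarrow> (real \<Rightarrow> (real \<Rightarrow> 'h) \<Rightarrow> 'h \<Rightarrow> real) \<Rightarrow> ((real \<Rightarrow> 'h) \<Rightarrow> real) \<Rightarrow>
   real \<Rightarrow> (real \<Rightarrow> 'h) set \<Rightarrow> (real \<Rightarrow> (real \<Rightarrow> 'h) \<Rightarrow> real) \<Rightarrow> bool" where
  "minimax_supersolution emb A T p q F h L \<Omega> u \<longleftrightarrow>
     lsc_wrt (d_inf T) ({0..T} \<times> \<Omega>) (\<lambda>(t, x). u t x) \<and>
     (\<forall>x\<in>\<Omega>. u T x \<ge> h x) \<and>
     (\<forall>t\<^sub>0\<in>{0..<T}. \<forall>x\<^sub>0\<in>\<Omega>. \<forall>z. \<exists>x\<in>\<Omega>. \<exists>X f. trajectory emb A T p q L t\<^sub>0 x\<^sub>0 x X f \<and>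
        (\<forall>t\<in>{t\<^sub>0..T}. u t\<^sub>0 x\<^sub>0 \<ge>
           integral\<^sup>L (lebesgue_on {t\<^sub>0..t}) (\<lambda>s. (- f s) \<bullet> z + F s x z) + u t x))"

section \<open>Test functions and viscosity subsolutions of the doubled equation\<close>

text \<open>\<open>\<phi>t\<close>, \<open>\<phi>x\<close>, \<open>\<phi>y\<close> are path derivatives of \<open>\<phi>\<close> on \<open>{a..T}\<close>. Integrability in the chain rule is
  stated explicitly, since the library integral of a non-integrable function is 0.\<close>

definition test_function ::
  "('v::banach \<Rightarrow>\<^sub>L 'h::{real_inner,complete_space}) \<Rightarrow> real \<Rightarrow> real \<Rightarrow> real \<Rightarrow> real \<Rightarrow>
   (real \<Rightarrow> (real \<Rightarrow> 'h) \<Rightarrow> (real \<Rightarrow> 'h) \<Rightarrow> real) \<Rightarrow>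
   (real \<Rightarrow> (real \<Rightarrow> 'h) \<Rightarrow> (real \<Rightarrow> 'h) \<Rightarrow> real) \<Rightarrow>
   (real \<Rightarrow> (real \<Rightarrow> 'h) \<Rightarrow> (real \<Rightarrow> 'h) \<Rightarrow> 'h) \<Rightarrow>
   (real \<Rightarrow> (real \<Rightarrow> 'h) \<Rightarrow> (real \<Rightarrow> 'h) \<Rightarrow> 'h) \<Rightarrow> bool" where
  "test_function emb T p q a \<phi> \<phi>t \<phi>x \<phi>y \<longleftrightarrow>
     cont_wrt (d_inf2 T) ({a..T} \<times> paths T \<times> paths T) (\<lambda>(t, x, y). \<phi> t x y) \<and>
     cont_wrt (d_inf2 T) ({a..T} \<times> paths T \<times> paths T) (\<lambda>(t, x, y). \<phi>t t x y) \<and>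
     cont_wrt (d_inf2 T) ({a..T} \<times> paths T \<times> paths T) (\<lambda>(t, x, y). \<phi>x t x y) \<and>
     cont_wrt (d_inf2 T) ({a..T} \<times> paths T \<times> paths T) (\<lambda>(t, x, y). \<phi>y t x y) \<and>
     (\<forall>x\<in>paths T. \<forall>y\<in>paths T. AE t in lebesgue_on {a..T}.
        (x t \<in> range (blinfun_apply emb) \<longrightarrow> \<phi>x t x y \<in> range (blinfun_apply emb)) \<and>
        (y t \<in> range (blinfun_apply emb) \<longrightarrow> \<phi>y t x y \<in> range (blinfun_apply emb))) \<and>
     (\<forall>t\<^sub>0\<in>{a..<T}. \<forall>x\<^sub>0\<in>paths T. \<forall>y\<^sub>0\<in>paths T. \<forall>x\<in>paths T. \<forall>y\<in>paths T. \<forall>X X' Y Y'.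
        W_pq emb p q t\<^sub>0 T X X' \<longrightarrow> W_pq emb p q t\<^sub>0 T Y Y' \<longrightarrow>
        (\<forall>t\<in>{0..t\<^sub>0}. x t = x\<^sub>0 t \<and> y t = y\<^sub>0 t) \<longrightarrow>
        (AE t in lebesgue_on {t\<^sub>0..T}.
           x t = blinfun_apply emb (X t) \<and> y t = blinfun_apply emb (Y t)) \<longrightarrow>
        (\<forall>t\<in>{t\<^sub>0..T}.
           (let g = (\<lambda>s. \<phi>t s x y + dual_pairing emb (X' s) (\<phi>x s x y)
                        + dual_pairing emb (Y' s) (\<phi>y s x y))
            in integrable (lebesgue_on {t\<^sub>0..t}) g \<and>
               \<phi> t x y - \<phi> t\<^sub>0 x\<^sub>0 y\<^sub>0 = integral\<^sup>L (lebesgue_on {t\<^sub>0..t}) g)))"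

text \<open>The infimum is taken in the extended reals, over the part of
  \<open>{t\<^sub>0..T\<^sub>0} \<times> trajectories \<times> trajectories\<close> on which \<open>w\<close> is defined, i.e. with paths in \<open>\<Omega>\<close>.\<close>

definition touches_from_above ::
  "('v::banach \<Rightarrow>\<^sub>L 'h::{real_inner,complete_space}) \<Rightarrow> (real \<Rightarrow> 'v \<Rightarrow> ('v \<Rightarrow>\<^sub>L real)) \<Rightarrow>
   real \<Rightarrow> real \<Rightarrow> real \<Rightarrow> real \<Rightarrow> (real \<Rightarrow> 'h) set \<Rightarrow>
   (real \<Rightarrow> (real \<Rightarrow> 'h) \<Rightarrow> (real \<Rightarrow> 'h) \<Rightarrow> real) \<Rightarrow> real \<Rightarrow> (real \<Rightarrow> 'h) \<Rightarrow> (real \<Rightarrow> 'h) \<Rightarrow>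
   (real \<Rightarrow> (real \<Rightarrow> 'h) \<Rightarrow> (real \<Rightarrow> 'h) \<Rightarrow> real) \<Rightarrow> bool" where
  "touches_from_above emb A T p q L \<Omega> w t\<^sub>0 x\<^sub>0 y\<^sub>0 \<phi> \<longleftrightarrow>
     (\<exists>T\<^sub>0\<in>{t\<^sub>0<..T}.
        \<phi> t\<^sub>0 x\<^sub>0 y\<^sub>0 - w t\<^sub>0 x\<^sub>0 y\<^sub>0 = 0 \<and>
        (INF (t, x, y) \<in> {t\<^sub>0..T\<^sub>0} \<times> (trajectories emb A T p q L t\<^sub>0 x\<^sub>0 \<inter> \<Omega>)
             \<times> (trajectories emb A T p q L t\<^sub>0 y\<^sub>0 \<inter> \<Omega>). ereal (\<phi> t x y - w t x y)) = 0)"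

definition viscosity_subsolution_doubled ::
  "('v::banach \<Rightarrow>\<^sub>L 'h::{real_inner,complete_space}) \<Rightarrow> (real \<Rightarrow> 'v \<Rightarrow> ('v \<Rightarrow>\<^sub>L real)) \<Rightarrow>
   real \<Rightarrow> real \<Rightarrow> real \<Rightarrow> (real \<Rightarrow> (real \<Rightarrow> 'h) \<Rightarrow> 'h \<Rightarrow> real) \<Rightarrow>
   real \<Rightarrow> (real \<Rightarrow> 'h) set \<Rightarrow> (real \<Rightarrow> (real \<Rightarrow> 'h) \<Rightarrow> (real \<Rightarrow> 'h) \<Rightarrow> real) \<Rightarrow> bool" where
  "viscosity_subsolution_doubled emb A T p q F L \<Omega> w \<longleftrightarrow>
     usc_wrt (d_inf2 T) ({0..T} \<times> \<Omega> \<times> \<Omega>) (\<lambda>(t, x, y). w t x y) \<and>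
     (\<forall>t\<^sub>0\<in>{0..<T}. \<forall>x\<^sub>0\<in>\<Omega>. \<forall>y\<^sub>0\<in>\<Omega>. \<forall>\<phi> \<phi>t \<phi>x \<phi>y.
        test_function emb T p q t\<^sub>0 \<phi> \<phi>t \<phi>x \<phi>y \<longrightarrow>
        touches_from_above emb A T p q L \<Omega> w t\<^sub>0 x\<^sub>0 y\<^sub>0 \<phi> \<longrightarrow>
        (\<exists>x X f y Y g.
           trajectory emb A T p q L t\<^sub>0 x\<^sub>0 x X f \<and> trajectory emb A T p q L t\<^sub>0 y\<^sub>0 y Y g \<and>
           (let k = (\<lambda>t. - dual_pairing emb (A t (X t)) (\<phi>x t x y)
                        - dual_pairing emb (A t (Y t)) (\<phi>y t x y))
            in integrable (lebesgue_on {t\<^sub>0..T}) k \<and>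
               ereal (\<phi>t t\<^sub>0 x\<^sub>0 y\<^sub>0)
               + Limsup (at_right 0)
                   (\<lambda>\<delta>. ereal (1 / \<delta> * integral\<^sup>L (lebesgue_on {t\<^sub>0..t\<^sub>0 + \<delta>}) k))
               + ereal (F t\<^sub>0 x\<^sub>0 (\<phi>x t\<^sub>0 x\<^sub>0 y\<^sub>0) - F t\<^sub>0 y\<^sub>0 (- \<phi>y t\<^sub>0 x\<^sub>0 y\<^sub>0)) \<ge> 0)))"

end

theory Submission
  imports Defs
begin

text \<open>Suppose that \<open>\<phi>\<close> touches \<open>w(t, x, y) = u(t, x) - v(t, y)\<close> from above at \<open>(t\<^sub>0, x\<^sub>0, y\<^sub>0)\<close>. The
  minimax inequalities hold for every direction \<open>z\<close>, so they may be used for the derivatives of \<open>\<phi>\<close>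
  at the contact point: \<open>\<zeta> = \<partial>\<^sub>x\<phi>\<close> for \<open>u\<close> and \<open>\<eta> = -\<partial>\<^sub>y\<phi>\<close> for \<open>v\<close>. They supply trajectories
  \<open>x\<close> and \<open>y\<close>, with right-hand sides \<open>f\<close> and \<open>g\<close>, along which \<open>w\<close> grows at least as fast as the
  integral of \<open>f \<bullet> \<zeta> - F(s, x, \<zeta>) - g \<bullet> \<eta> + F(s, y, \<eta>)\<close>. Since \<open>\<phi> - w\<close> is minimal at the contact
  point, \<open>\<phi>\<close> grows at least as fast as \<open>w\<close>.

  On the other hand, the chain rule for test functions computes the growth of \<open>\<phi>\<close>. Inserting
  \<open>X' = f - A(s, X)\<close> and \<open>Y' = g - A(s, Y)\<close> (\<open>test_function_chain_rule\<close>) it is the integral of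
  \<open>\<partial>\<^sub>t\<phi> + f \<bullet> \<partial>\<^sub>x\<phi> + g \<bullet> \<partial>\<^sub>y\<phi> + k\<close>, where \<open>k\<close> collects the pairings with \<open>A\<close>. In the comparison of the
  two, \<open>f\<close> and \<open>g\<close> survive only against \<open>\<partial>\<^sub>x\<phi> - \<zeta>\<close> and \<open>\<partial>\<^sub>y\<phi> + \<eta>\<close>. These differences
  tend to 0 along the trajectories, while \<open>f\<close> and \<open>g\<close> are bounded (\<open>trajectory_rhs_bounded\<close>). Hence the
  integral of \<open>k\<close> dominates the integral of a continuous function whose value at \<open>t\<^sub>0\<close> is
  \<open>-\<partial>\<^sub>t\<phi> - F(t\<^sub>0, x\<^sub>0, \<zeta>) + F(t\<^sub>0, y\<^sub>0, \<eta>)\<close>, and so do its averages over shrinking intervals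
  (\<open>Limsup_average_ge\<close>, \<open>contact_inequality\<close>). This is the viscosity inequality.\<close>

section \<open>Lebesgue integration on intervals\<close>

lemma AE_lebesgue_on_subset:
  assumes "AE t in lebesgue_on S. P t" "R \<subseteq> S" "R \<in> sets lebesgue" "S \<in> sets lebesgue"
  shows "AE t in lebesgue_on R. P t"
  using assms by (auto simp: AE_restrict_space_iff elim!: eventually_mono)

lemma integrable_lebesgue_on_subset:
  fixes f :: "real \<Rightarrow> real"
  assumes "integrable (lebesgue_on S) f" "R \<subseteq> S" "R \<in> sets lebesgue" "S \<in> sets lebesgue"
  shows "integrable (lebesgue_on R) f"
proof -
  have "set_integrable lebesgue S f"
    using assms by (simp add: set_integrable_def integrable_restrict_space)
  then have "set_integrable lebesgue R f"
    by (rule set_integrable_subset) (use assms in auto)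
  then show ?thesis
    using assms by (simp add: set_integrable_def integrable_restrict_space)
qed

lemma borel_measurable_lebesgue_on_AE:
  fixes f g :: "real \<Rightarrow> real"
  assumes S: "S \<in> sets lebesgue"
    and f: "f \<in> borel_measurable (lebesgue_on S)"
    and ae: "AE t in lebesgue_on S. f t = g t"
  shows "g \<in> borel_measurable (lebesgue_on S)"
proof -
  have "(\<lambda>t. if t \<in> S then f t else 0) \<in> borel_measurable lebesgue"
    using f S by (simp add: borel_measurable_if)
  moreover have "AE t in lebesgue. (if t \<in> S then f t else 0) = (if t \<in> S then g t else 0)"
    using ae S by (auto simp: AE_restrict_space_iff elim!: eventually_mono)
  ultimately have "(\<lambda>t. if t \<in> S then g t else 0) \<in> borel_measurable lebesgue"
    by (rule borel_measurable_AE)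
  then show ?thesis
    using S by (simp add: borel_measurable_if)
qed

lemma integrable_lebesgue_on_AE:
  fixes f g :: "real \<Rightarrow> real"
  assumes "S \<in> sets lebesgue" "integrable (lebesgue_on S) f" "AE t in lebesgue_on S. f t = g t"
  shows "integrable (lebesgue_on S) g"
    and "integral\<^sup>L (lebesgue_on S) g = integral\<^sup>L (lebesgue_on S) f"
proof -
  have g: "g \<in> borel_measurable (lebesgue_on S)"
    using assms by (blast intro: borel_measurable_lebesgue_on_AE)
  show "integrable (lebesgue_on S) g"
    using assms(2) g assms(3) by (rule integrable_cong_AE_imp)
  show "integral\<^sup>L (lebesgue_on S) g = integral\<^sup>L (lebesgue_on S) f"
    using assms g by (intro integral_cong_AE) (auto elim!: eventually_mono)
qed

text \<open>The space may fail to be second countable, so the pair \<open>(f, \<phi>)\<close> cannot simply be composed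
  with the continuous inner product. Instead \<open>f\<close> is approximated by simple functions: each of them
  splits the domain into finitely many measurable pieces, and on each piece its product with
  \<open>\<phi>\<close> is continuous.\<close>

lemma strongly_measurable_inner:
  fixes f \<phi> :: "real \<Rightarrow> 'h::real_inner"
  assumes S: "S \<in> sets lebesgue"
    and f: "strongly_measurable_on S f" and \<phi>: "continuous_on S \<phi>"
  shows "(\<lambda>t. f t \<bullet> \<phi> t) \<in> borel_measurable (lebesgue_on S)"
proof -
  obtain s where s: "\<And>n. simple_function (lebesgue_on S) (s n)"
    and lim: "AE t in lebesgue_on S. (\<lambda>n. s n t) \<longlonglongrightarrow> f t"
    using f unfolding strongly_measurable_on_def by auto
  have meas: "(\<lambda>t. s n t \<bullet> \<phi> t) \<in> borel_measurable (lebesgue_on S)" for n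
  proof (rule measurable_compose_countable'[where I = "s n ` space (lebesgue_on S)"
        and f = "\<lambda>c t. c \<bullet> \<phi> t"])
    show "(\<lambda>t. c \<bullet> \<phi> t) \<in> borel_measurable (lebesgue_on S)" for c
      using S \<phi> by (intro continuous_imp_measurable_on_sets_lebesgue continuous_intros)
    show "countable (s n ` space (lebesgue_on S))"
      using simple_functionD(1)[OF s[of n]] by (rule countable_finite)
    show "s n \<in> measurable (lebesgue_on S) (count_space (s n ` space (lebesgue_on S)))"
      using s[of n] simple_functionD(1)[OF s[of n]] simple_functionD(2)[OF s[of n]]
      by (subst measurable_count_space_eq2) auto
  qed
  define g where "g t = lim (\<lambda>n. s n t \<bullet> \<phi> t)" for t
  have "g \<in> borel_measurable (lebesgue_on S)"
    unfolding g_def using meas by (rule borel_measurable_lim_metric)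
  moreover have "AE t in lebesgue_on S. g t = f t \<bullet> \<phi> t"
    using lim
  proof eventually_elim
    case (elim t)
    then have "(\<lambda>n. s n t \<bullet> \<phi> t) \<longlonglongrightarrow> f t \<bullet> \<phi> t"
      by (intro tendsto_intros)
    then show ?case
      unfolding g_def by (rule limI)
  qed
  ultimately show ?thesis
    using S by (blast intro: borel_measurable_lebesgue_on_AE)
qed

lemma integrable_inner_bounded:
  fixes f \<phi> :: "real \<Rightarrow> 'h::real_inner"
  assumes f: "strongly_measurable_on {a..b} f" and \<phi>: "continuous_on {a..b} \<phi>"
    and M: "AE t in lebesgue_on {a..b}. norm (f t) \<le> M"
  shows "integrable (lebesgue_on {a..b}) (\<lambda>t. f t \<bullet> \<phi> t)"
proof -
  interpret finite_measure "lebesgue_on {a..b}"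
    by (rule finite_measure_lebesgue_on) auto
  obtain N where N: "\<And>t. t \<in> {a..b} \<Longrightarrow> norm (\<phi> t) \<le> N"
    using compact_imp_bounded[OF compact_continuous_image[OF \<phi> compact_Icc]]
    unfolding bounded_iff by (metis imageI)
  show ?thesis
  proof (rule integrable_const_bound)
    have "AE t in lebesgue_on {a..b}. t \<in> {a..b}"
      by (rule AE_I2) simp
    with M show "AE t in lebesgue_on {a..b}. norm (f t \<bullet> \<phi> t) \<le> M * N"
    proof eventually_elim
      case (elim t)
      have "norm (f t \<bullet> \<phi> t) \<le> norm (f t) * norm (\<phi> t)"
        by (simp add: Cauchy_Schwarz_ineq2)
      also have "\<dots> \<le> M * N"
        using elim N[of t] by (intro mult_mono) (auto intro: order_trans[OF norm_ge_zero])
      finally show ?case .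
    qed
    show "(\<lambda>t. f t \<bullet> \<phi> t) \<in> borel_measurable (lebesgue_on {a..b})"
      using f \<phi> by (intro strongly_measurable_inner) auto
  qed
qed

text \<open>Near \<open>a\<close> the function \<open>R\<close> exceeds \<open>c - e\<close>, hence so do its averages over short intervals
  starting at \<open>a\<close>, and the averages of \<open>k\<close> dominate them. Only integrals of \<open>k\<close> are compared with
  integrals of \<open>R\<close>: in the application \<open>R \<le> k\<close> may fail pointwise.\<close>

lemma Limsup_average_ge:
  fixes R k :: "real \<Rightarrow> real"
  assumes "a < b"
    and lim: "(R \<longlongrightarrow> c) (at a within {a..b})"
    and int: "\<And>t. t \<in> {a..b} \<Longrightarrow> integrable (lebesgue_on {a..t}) R"
    and le: "\<And>t. t \<in> {a..b} \<Longrightarrow>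
      integral\<^sup>L (lebesgue_on {a..t}) R \<le> integral\<^sup>L (lebesgue_on {a..t}) k"
  shows "ereal c \<le>
    Limsup (at_right 0) (\<lambda>\<delta>. ereal (1 / \<delta> * integral\<^sup>L (lebesgue_on {a..a + \<delta>}) k))"
proof (rule ereal_le_epsilon2)
  fix e :: real assume "e > 0"
  then have "eventually (\<lambda>s. c - e < R s) (at a within {a..b})"
    using order_tendstoD(1)[OF lim, of "c - e"] by simp
  then obtain d where "d > 0"
    and d: "\<And>s. s \<in> {a..b} \<Longrightarrow> s \<noteq> a \<Longrightarrow> dist s a < d \<Longrightarrow> c - e < R s"
    unfolding eventually_at by auto
  have "ereal (c - e) \<le>
    Limsup (at_right 0) (\<lambda>\<delta>. ereal (1 / \<delta> * integral\<^sup>L (lebesgue_on {a..a + \<delta>}) k))"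
  proof (rule le_Limsup)
    have "eventually (\<lambda>\<delta>. \<delta> \<in> {0<..<min d (b - a)}) (at_right (0::real))"
      using \<open>d > 0\<close> \<open>a < b\<close> by (intro eventually_at_right_real) auto
    then show "eventually (\<lambda>\<delta>. ereal (c - e) \<le>
        ereal (1 / \<delta> * integral\<^sup>L (lebesgue_on {a..a + \<delta>}) k)) (at_right 0)"
    proof eventually_elim
      case (elim \<delta>)
      have "integral\<^sup>L (lebesgue_on {a..a + \<delta>}) (\<lambda>_. c - e)
          \<le> integral\<^sup>L (lebesgue_on {a..a + \<delta>}) R"
      proof (rule integral_mono_AE)
        show "integrable (lebesgue_on {a..a + \<delta>}) R"
          using elim by (intro int) auto
        have "AE s in lebesgue. s \<noteq> a"
          using AE_lborel_singleton[of a] by (rule AE_completion)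
        then show "AE s in lebesgue_on {a..a + \<delta>}. c - e \<le> R s"
          using elim by (auto simp: AE_restrict_space_iff dist_real_def
              intro!: less_imp_le[OF d] elim!: eventually_mono)
      qed (auto intro!: finite_measure.integrable_const finite_measure_lebesgue_on)
      then have "\<delta> * (c - e) \<le> integral\<^sup>L (lebesgue_on {a..a + \<delta>}) R"
        using elim by (simp add: measure_restrict_space)
      also have "\<dots> \<le> integral\<^sup>L (lebesgue_on {a..a + \<delta>}) k"
        using elim by (intro le) auto
      finally show ?case
        using elim by (simp add: field_simps)
    qed
  qed simp
  then show "ereal c \<le>
    Limsup (at_right 0) (\<lambda>\<delta>. ereal (1 / \<delta> * integral\<^sup>L (lebesgue_on {a..a + \<delta>}) k)) + ereal e"
    by (cases "Limsup (at_right 0) (\<lambda>\<delta>. ereal (1 / \<delta> * integral\<^sup>L (lebesgue_on {a..a + \<delta>}) k))")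
       (auto simp: algebra_simps)
qed

section \<open>Continuity of functionals along a path\<close>

lemma paths_bounded:
  assumes "x \<in> paths T"
  obtains M where "\<And>s. s \<in> {0..T} \<Longrightarrow> norm (x s) \<le> M"
proof -
  have "bounded (x ` {0..T})"
    using assms unfolding paths_def
    by (auto intro: compact_imp_bounded compact_continuous_image)
  then show ?thesis
    using that unfolding bounded_iff by (metis imageI)
qed

lemma stopped_path_distance_bounded:
  assumes "x \<in> paths T" "y \<in> paths T" "t \<in> {0..T}" "s \<in> {0..T}"
  shows "bdd_above ((\<lambda>r. norm (x (min r t) - y (min r s))) ` {0..T})"
proof -
  obtain M N where "\<And>s. s \<in> {0..T} \<Longrightarrow> norm (x s) \<le> M" "\<And>s. s \<in> {0..T} \<Longrightarrow> norm (y s) \<le> N"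
    using paths_bounded assms by metis
  then have "norm (x (min r t) - y (min r s)) \<le> M + N" if "r \<in> {0..T}" for r
    using that assms by (intro norm_triangle_le_diff add_mono) auto
  then show ?thesis
    by (rule bdd_aboveI2)
qed

lemma d_inf_nonneg:
  assumes "x \<in> paths T" "y \<in> paths T" "t \<in> {0..T}" "s \<in> {0..T}"
  shows "0 \<le> d_inf T (t, x) (s, y)"
proof -
  have "0 \<le> norm (x (min 0 t) - y (min 0 s))" by simp
  also have "\<dots> \<le> (SUP r\<in>{0..T}. norm (x (min r t) - y (min r s)))"
    using assms by (intro cSUP_upper stopped_path_distance_bounded) auto
  finally show ?thesis
    unfolding d_inf_def by simp
qed

lemma d_inf2_le:
  assumes "x \<in> paths T" "y \<in> paths T" "x' \<in> paths T" "y' \<in> paths T" "t \<in> {0..T}" "s \<in> {0..T}"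
  shows "d_inf2 T (t, x, y) (s, x', y') \<le> d_inf T (t, x) (s, x') + d_inf T (t, y) (s, y')"
proof -
  have "(SUP r\<in>{0..T}. norm ((x (min r t), y (min r t)) - (x' (min r s), y' (min r s))))
    \<le> (SUP r\<in>{0..T}. norm (x (min r t) - x' (min r s)))
      + (SUP r\<in>{0..T}. norm (y (min r t) - y' (min r s)))"
  proof (rule cSUP_least)
    fix r assume "r \<in> {0..T}"
    then have "norm (x (min r t) - x' (min r s)) + norm (y (min r t) - y' (min r s))
      \<le> (SUP r\<in>{0..T}. norm (x (min r t) - x' (min r s)))
      + (SUP r\<in>{0..T}. norm (y (min r t) - y' (min r s)))"
      using assms by (intro add_mono cSUP_upper stopped_path_distance_bounded) auto
    moreover have "norm ((x (min r t), y (min r t)) - (x' (min r s), y' (min r s)))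
      \<le> norm (x (min r t) - x' (min r s)) + norm (y (min r t) - y' (min r s))"
      using norm_Pair_le[of "x (min r t) - x' (min r s)" "y (min r t) - y' (min r s)"] by simp
    ultimately show "norm ((x (min r t), y (min r t)) - (x' (min r s), y' (min r s)))
      \<le> (SUP r\<in>{0..T}. norm (x (min r t) - x' (min r s)))
      + (SUP r\<in>{0..T}. norm (y (min r t) - y' (min r s)))" by linarith
  qed (use assms in auto)
  then show ?thesis
    unfolding d_inf_def d_inf2_def by simp
qed

lemma d_inf_le_d_inf2:
  assumes "x \<in> paths T" "y \<in> paths T" "x' \<in> paths T" "y' \<in> paths T" "t \<in> {0..T}" "s \<in> {0..T}"
  shows "d_inf T (t, x) (s, x') \<le> d_inf2 T (t, x, y) (s, x', y')"
    and "d_inf T (t, y) (s, y') \<le> d_inf2 T (t, x, y) (s, x', y')"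
proof -
  obtain N where N: "\<And>r. r \<in> {0..T} \<Longrightarrow> norm (x (min r t) - x' (min r s)) \<le> N"
    using stopped_path_distance_bounded[OF assms(1,3,5,6)] unfolding bdd_above_def by blast
  obtain M where M: "\<And>r. r \<in> {0..T} \<Longrightarrow> norm (y (min r t) - y' (min r s)) \<le> M"
    using stopped_path_distance_bounded[OF assms(2,4,5,6)] unfolding bdd_above_def by blast
  from N M have "norm ((x (min r t), y (min r t)) - (x' (min r s), y' (min r s))) \<le> N + M"
    if "r \<in> {0..T}" for r
    using norm_Pair_le[of "x (min r t) - x' (min r s)" "y (min r t) - y' (min r s)"]
      N[OF that] M[OF that] by simp
  then have bdd: "bdd_above ((\<lambda>r. norm ((x (min r t), y (min r t)) - (x' (min r s), y' (min r s))))
      ` {0..T})"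
    by (rule bdd_aboveI2)
  have "(SUP r\<in>{0..T}. norm (x (min r t) - x' (min r s)))
      \<le> (SUP r\<in>{0..T}. norm ((x (min r t), y (min r t)) - (x' (min r s), y' (min r s))))"
    using assms norm_fst_le by (intro cSUP_mono bdd) fastforce+
  then show "d_inf T (t, x) (s, x') \<le> d_inf2 T (t, x, y) (s, x', y')"
    unfolding d_inf_def d_inf2_def by simp
  have "(SUP r\<in>{0..T}. norm (y (min r t) - y' (min r s)))
      \<le> (SUP r\<in>{0..T}. norm ((x (min r t), y (min r t)) - (x' (min r s), y' (min r s))))"
    using assms norm_snd_le by (intro cSUP_mono bdd) fastforce+
  then show "d_inf T (t, y) (s, y') \<le> d_inf2 T (t, x, y) (s, x', y')"
    unfolding d_inf_def d_inf2_def by simp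
qed

text \<open>Uniform continuity of \<open>x\<close> makes stopping at \<open>t\<close> and at a nearby \<open>s\<close> almost the same. The
  reference path \<open>x\<^sub>0\<close> may be any path with the same past, because \<open>d_inf\<close> only sees the path
  stopped at \<open>t\<close>.\<close>

lemma d_inf_tendsto_0:
  assumes x: "x \<in> paths T" and x0: "x\<^sub>0 \<in> paths T" and t: "t \<in> {0..T}"
    and past: "\<And>r. r \<in> {0..t} \<Longrightarrow> x r = x\<^sub>0 r"
  shows "((\<lambda>s. d_inf T (t, x\<^sub>0) (s, x)) \<longlongrightarrow> 0) (at t within {0..T})"
proof (rule tendstoI)
  fix e :: real assume "e > 0"
  have "uniformly_continuous_on {0..T} x"
    using x unfolding paths_def by (auto intro: compact_uniformly_continuous)
  then obtain d where "d > 0" and d: "\<And>r r'. r \<in> {0..T} \<Longrightarrow> r' \<in> {0..T} \<Longrightarrow> dist r' r < d \<Longrightarrow>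
      dist (x r') (x r) < e / 4"
    using \<open>e > 0\<close> unfolding uniformly_continuous_on_def
    by (metis divide_pos_pos zero_less_numeral)
  have "d_inf T (t, x\<^sub>0) (s, x) < e" if s: "s \<in> {0..T}" "dist s t < min d (e / 4)" for s
  proof -
    have "(SUP r\<in>{0..T}. norm (x\<^sub>0 (min r t) - x (min r s))) \<le> e / 4"
    proof (rule cSUP_least)
      fix r assume r: "r \<in> {0..T}"
      have "x\<^sub>0 (min r t) = x (min r t)"
        using r t by (intro past[symmetric]) auto
      moreover have "dist (x (min r t)) (x (min r s)) < e / 4"
        using r s t by (intro d) (auto simp: dist_real_def)
      ultimately show "norm (x\<^sub>0 (min r t) - x (min r s)) \<le> e / 4"
        by (simp add: dist_norm)
    qed (use t in auto)
    then show ?thesis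
      using s \<open>e > 0\<close> unfolding d_inf_def dist_real_def split_conv by linarith
  qed
  then have "dist (d_inf T (t, x\<^sub>0) (s, x)) 0 < e"
    if "s \<in> {0..T}" "dist s t < min d (e / 4)" for s
    using that d_inf_nonneg[OF x0 x t, of s] by (simp add: dist_real_def)
  then show "eventually (\<lambda>s. dist (d_inf T (t, x\<^sub>0) (s, x)) 0 < e) (at t within {0..T})"
    unfolding eventually_at using \<open>d > 0\<close> \<open>e > 0\<close>
    by (intro exI[of _ "min d (e / 4)"]) auto
qed

lemma cont_wrt_tendsto:
  assumes "cont_wrt d S f" "a \<in> S" "eventually (\<lambda>s. c s \<in> S) G" "((\<lambda>s. d a (c s)) \<longlongrightarrow> 0) G"
  shows "((\<lambda>s. f (c s)) \<longlongrightarrow> f a) G"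
proof (rule tendstoI)
  fix e :: real assume "e > 0"
  then obtain \<delta> where "\<delta> > 0" and \<delta>: "\<And>b. b \<in> S \<Longrightarrow> d a b < \<delta> \<Longrightarrow> dist (f b) (f a) < e"
    using assms(1,2) unfolding cont_wrt_def by meson
  show "eventually (\<lambda>s. dist (f (c s)) (f a) < e) G"
    using assms(3) order_tendstoD(2)[OF assms(4) \<open>\<delta> > 0\<close>]
    by eventually_elim (rule \<delta>)
qed

lemma cont_wrt_d_inf_tendsto:
  assumes f: "cont_wrt (d_inf T) ({a..T} \<times> paths T) (\<lambda>(t, x). f t x)"
    and "0 \<le> a" "t \<in> {a..T}" "x \<in> paths T" "x\<^sub>0 \<in> paths T" "\<And>r. r \<in> {0..t} \<Longrightarrow> x r = x\<^sub>0 r"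
  shows "((\<lambda>s. f s x) \<longlongrightarrow> f t x\<^sub>0) (at t within {a..T})"
proof -
  have "((\<lambda>s. d_inf T (t, x\<^sub>0) (s, x)) \<longlongrightarrow> 0) (at t within {a..T})"
    using assms by (intro tendsto_within_subset[OF d_inf_tendsto_0]) auto
  then have "((\<lambda>s. (\<lambda>(t, x). f t x) (s, x)) \<longlongrightarrow> (\<lambda>(t, x). f t x) (t, x\<^sub>0)) (at t within {a..T})"
    using assms by (intro cont_wrt_tendsto[OF f]) (auto simp: eventually_at_filter)
  then show ?thesis by simp
qed

lemma cont_wrt_d_inf2_tendsto:
  assumes f: "cont_wrt (d_inf2 T) ({a..T} \<times> paths T \<times> paths T) (\<lambda>(t, x, y). f t x y)"
    and "0 \<le> a" "t \<in> {a..T}" "x \<in> paths T" "x\<^sub>0 \<in> paths T" "y \<in> paths T" "y\<^sub>0 \<in> paths T"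
    and "\<And>r. r \<in> {0..t} \<Longrightarrow> x r = x\<^sub>0 r" "\<And>r. r \<in> {0..t} \<Longrightarrow> y r = y\<^sub>0 r"
  shows "((\<lambda>s. f s x y) \<longlongrightarrow> f t x\<^sub>0 y\<^sub>0) (at t within {a..T})"
proof -
  have "((\<lambda>s. d_inf T (t, x\<^sub>0) (s, x) + d_inf T (t, y\<^sub>0) (s, y)) \<longlongrightarrow> 0 + 0) (at t within {a..T})"
    using assms by (intro tendsto_add tendsto_within_subset[OF d_inf_tendsto_0]) auto
  then have upper: "((\<lambda>s. d_inf T (t, x\<^sub>0) (s, x) + d_inf T (t, y\<^sub>0) (s, y)) \<longlongrightarrow> 0)
      (at t within {a..T})" by simp
  have bounds: "0 \<le> d_inf2 T (t, x\<^sub>0, y\<^sub>0) (s, x, y) \<and> d_inf2 T (t, x\<^sub>0, y\<^sub>0) (s, x, y)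
      \<le> d_inf T (t, x\<^sub>0) (s, x) + d_inf T (t, y\<^sub>0) (s, y)" if "s \<in> {a..T}" for s
    using assms that d_inf_le_d_inf2(1)[of x\<^sub>0 T y\<^sub>0 x y t s] d_inf_nonneg[of x\<^sub>0 T x t s]
    by (auto intro!: d_inf2_le)
  have "((\<lambda>s. d_inf2 T (t, x\<^sub>0, y\<^sub>0) (s, x, y)) \<longlongrightarrow> 0) (at t within {a..T})"
    using bounds by (intro tendsto_sandwich[OF _ _ tendsto_const upper])
      (auto simp: eventually_at_filter)
  then have "((\<lambda>s. (\<lambda>(t, x, y). f t x y) (s, x, y)) \<longlongrightarrow> (\<lambda>(t, x, y). f t x y) (t, x\<^sub>0, y\<^sub>0))
      (at t within {a..T})"
    using assms by (intro cont_wrt_tendsto[OF f]) (auto simp: eventually_at_filter)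
  then show ?thesis by simp
qed

text \<open>Closeness of pairs of stopped paths implies closeness of each stopped path, and the
  semicontinuity bounds of \<open>u\<close> and \<open>v\<close> at level \<open>e / 2\<close> can be added.\<close>

lemma usc_wrt_diff:
  assumes u: "usc_wrt (d_inf T) ({0..T} \<times> \<Omega>) (\<lambda>(t, x). u t x)"
    and v: "lsc_wrt (d_inf T) ({0..T} \<times> \<Omega>) (\<lambda>(t, x). v t x)"
    and \<Omega>: "\<Omega> \<subseteq> paths T"
  shows "usc_wrt (d_inf2 T) ({0..T} \<times> \<Omega> \<times> \<Omega>) (\<lambda>(t, x, y). u t x - v t y)"
  unfolding usc_wrt_def
proof (intro ballI allI impI)
  fix a and e :: real
  assume "a \<in> {0..T} \<times> \<Omega> \<times> \<Omega>" and "e > 0"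
  then obtain t x y where a: "a = (t, x, y)"
    and t: "t \<in> {0..T}" and x: "x \<in> \<Omega>" and y: "y \<in> \<Omega>" by auto
  from \<open>e > 0\<close> have e2: "e / 2 > 0" by simp
  have tx: "(t, x) \<in> {0..T} \<times> \<Omega>" and ty: "(t, y) \<in> {0..T} \<times> \<Omega>" using t x y by auto
  obtain \<alpha> where "\<alpha> > 0"
    and \<alpha>: "\<And>b. b \<in> {0..T} \<times> \<Omega> \<Longrightarrow> d_inf T (t, x) b < \<alpha> \<Longrightarrow>
      (\<lambda>(t, x). u t x) b < (\<lambda>(t, x). u t x) (t, x) + e / 2"
    using u[unfolded usc_wrt_def, rule_format, OF tx e2] by blast
  obtain \<beta> where "\<beta> > 0"
    and \<beta>: "\<And>b. b \<in> {0..T} \<times> \<Omega> \<Longrightarrow> d_inf T (t, y) b < \<beta> \<Longrightarrow>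
      (\<lambda>(t, x). v t x) (t, y) - e / 2 < (\<lambda>(t, x). v t x) b"
    using v[unfolded lsc_wrt_def, rule_format, OF ty e2] by blast
  have "u s x' - v s y' < u t x - v t y + e"
    if "s \<in> {0..T}" "x' \<in> \<Omega>" "y' \<in> \<Omega>" "d_inf2 T (t, x, y) (s, x', y') < min \<alpha> \<beta>" for s x' y'
  proof -
    have "d_inf T (t, x) (s, x') < \<alpha>" "d_inf T (t, y) (s, y') < \<beta>"
      using d_inf_le_d_inf2[of x T y x' y' t s] t x y that \<Omega>
      by (auto intro: le_less_trans)
    then show ?thesis
      using \<alpha>[of "(s, x')"] \<beta>[of "(s, y')"] that by auto
  qed
  then show "\<exists>\<delta>>0. \<forall>b\<in>{0..T} \<times> \<Omega> \<times> \<Omega>. d_inf2 T a b < \<delta> \<longrightarrow>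
      (case b of (t, x, y) \<Rightarrow> u t x - v t y) < (case a of (t, x, y) \<Rightarrow> u t x - v t y) + e"
    unfolding a using \<open>\<alpha> > 0\<close> \<open>\<beta> > 0\<close> by (intro exI[of _ "min \<alpha> \<beta>"]) auto
qed

section \<open>Trajectories and test functions\<close>

lemma dual_pairing_H_to_dual_diff:
  assumes "k \<in> range (blinfun_apply emb)"
  shows "dual_pairing emb (H_to_dual emb h - \<xi>) k = h \<bullet> k - dual_pairing emb \<xi> k"
  using assms
  by (simp add: dual_pairing_def H_to_dual_def blinfun.diff_left f_inv_into_f inner_commute)

lemma trajectory_rhs_bounded:
  assumes "trajectory emb A T p q L t\<^sub>0 x\<^sub>0 x X f" "0 \<le> t\<^sub>0" "0 \<le> L"
  obtains M where "AE t in lebesgue_on {t\<^sub>0..T}. norm (f t) \<le> M"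
proof -
  obtain N where N: "\<And>s. s \<in> {0..T} \<Longrightarrow> norm (x s) \<le> N"
    using assms(1) paths_bounded unfolding trajectory_def by metis
  have "AE t in lebesgue_on {t\<^sub>0..T}. norm (f t) \<le> L * (1 + sup_upto t x)"
    using assms(1) unfolding trajectory_def by blast
  moreover have "AE t in lebesgue_on {t\<^sub>0..T}. t \<in> {t\<^sub>0..T}"
    by (rule AE_I2) simp
  ultimately have "AE t in lebesgue_on {t\<^sub>0..T}. norm (f t) \<le> L * (1 + N)"
  proof eventually_elim
    case (elim t)
    have "sup_upto t x \<le> N"
      unfolding sup_upto_def using elim \<open>0 \<le> t\<^sub>0\<close> by (intro cSUP_least N) auto
    then have "L * (1 + sup_upto t x) \<le> L * (1 + N)"
      using \<open>0 \<le> L\<close> by (intro mult_left_mono) auto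
    with elim show ?case by linarith
  qed
  then show ?thesis by (rule that)
qed

text \<open>All integrands that contain a right-hand side are of this form, either with a constant
  \<open>\<psi>\<close> (in the minimax inequalities) or with a path derivative of a test function.\<close>

lemma trajectory_rhs_inner_integrable:
  assumes x: "trajectory emb A T p q L t\<^sub>0 x\<^sub>0 x X f" and "0 \<le> t\<^sub>0" "0 \<le> L"
    and \<psi>: "continuous_on {t\<^sub>0..T} \<psi>" and t: "t \<in> {t\<^sub>0..T}"
  shows "integrable (lebesgue_on {t\<^sub>0..t}) (\<lambda>s. f s \<bullet> \<psi> s)"
proof -
  obtain M where "AE t in lebesgue_on {t\<^sub>0..T}. norm (f t) \<le> M"
    using trajectory_rhs_bounded assms by metis
  moreover have "strongly_measurable_on {t\<^sub>0..T} f"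
    using x unfolding trajectory_def Lp_on_def by blast
  ultimately have "integrable (lebesgue_on {t\<^sub>0..T}) (\<lambda>s. f s \<bullet> \<psi> s)"
    using \<psi> by (intro integrable_inner_bounded)
  then show ?thesis
    by (rule integrable_lebesgue_on_subset) (use t in auto)
qed

text \<open>Substituting \<open>X' = f - A(\<cdot>, X)\<close> in the chain rule splits it into a bounded part and the
  part driven by the operator \<open>A\<close>. The operator part inherits its integrability from
  the whole integrand, for which the definition of a test function guarantees it.\<close>

lemma test_function_chain_rule:
  assumes \<phi>: "test_function emb T p q t\<^sub>0 \<phi> \<phi>t \<phi>x \<phi>y"
    and x: "trajectory emb A T p q L t\<^sub>0 x\<^sub>0 x X f" and y: "trajectory emb A T p q L t\<^sub>0 y\<^sub>0 y Y g"
    and x0: "x\<^sub>0 \<in> paths T" and y0: "y\<^sub>0 \<in> paths T"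
    and t0: "0 \<le> t\<^sub>0" "t\<^sub>0 < T" and t: "t \<in> {t\<^sub>0..T}"
    and P: "integrable (lebesgue_on {t\<^sub>0..t}) (\<lambda>s. \<phi>t s x y + f s \<bullet> \<phi>x s x y + g s \<bullet> \<phi>y s x y)"
  defines "k \<equiv> \<lambda>s. - dual_pairing emb (A s (X s)) (\<phi>x s x y)
                  - dual_pairing emb (A s (Y s)) (\<phi>y s x y)"
  shows "integrable (lebesgue_on {t\<^sub>0..t}) k"
    and "integral\<^sup>L (lebesgue_on {t\<^sub>0..t}) k = \<phi> t x y - \<phi> t\<^sub>0 x\<^sub>0 y\<^sub>0
      - integral\<^sup>L (lebesgue_on {t\<^sub>0..t}) (\<lambda>s. \<phi>t s x y + f s \<bullet> \<phi>x s x y + g s \<bullet> \<phi>y s x y)"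
proof -
  obtain X' where X': "W_pq emb p q t\<^sub>0 T X X'"
    and eqX: "AE s in lebesgue_on {t\<^sub>0..T}. X' s + A s (X s) = H_to_dual emb (f s)"
    and xp: "x \<in> paths T" "\<And>r. r \<in> {0..t\<^sub>0} \<Longrightarrow> x r = x\<^sub>0 r"
    and xX: "AE s in lebesgue_on {t\<^sub>0..T}. x s = blinfun_apply emb (X s)"
    using x unfolding trajectory_def by blast
  obtain Y' where Y': "W_pq emb p q t\<^sub>0 T Y Y'"
    and eqY: "AE s in lebesgue_on {t\<^sub>0..T}. Y' s + A s (Y s) = H_to_dual emb (g s)"
    and yp: "y \<in> paths T" "\<And>r. r \<in> {0..t\<^sub>0} \<Longrightarrow> y r = y\<^sub>0 r"
    and yY: "AE s in lebesgue_on {t\<^sub>0..T}. y s = blinfun_apply emb (Y s)"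
    using y unfolding trajectory_def by blast
  define G where "G = (\<lambda>s. \<phi>t s x y + dual_pairing emb (X' s) (\<phi>x s x y)
                        + dual_pairing emb (Y' s) (\<phi>y s x y))"
  let ?P = "\<lambda>s. \<phi>t s x y + f s \<bullet> \<phi>x s x y + g s \<bullet> \<phi>y s x y"
  have xXyY: "AE s in lebesgue_on {t\<^sub>0..T}.
      x s = blinfun_apply emb (X s) \<and> y s = blinfun_apply emb (Y s)"
    using xX yY by eventually_elim simp
  have chain: "\<forall>t\<^sub>1\<in>{t\<^sub>0..<T}. \<forall>x\<^sub>1\<in>paths T. \<forall>y\<^sub>1\<in>paths T. \<forall>x\<in>paths T. \<forall>y\<in>paths T. \<forall>X X' Y Y'.
        W_pq emb p q t\<^sub>1 T X X' \<longrightarrow> W_pq emb p q t\<^sub>1 T Y Y' \<longrightarrow>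
        (\<forall>t\<in>{0..t\<^sub>1}. x t = x\<^sub>1 t \<and> y t = y\<^sub>1 t) \<longrightarrow>
        (AE t in lebesgue_on {t\<^sub>1..T}.
           x t = blinfun_apply emb (X t) \<and> y t = blinfun_apply emb (Y t)) \<longrightarrow>
        (\<forall>t\<in>{t\<^sub>1..T}.
           (let g = (\<lambda>s. \<phi>t s x y + dual_pairing emb (X' s) (\<phi>x s x y)
                        + dual_pairing emb (Y' s) (\<phi>y s x y))
            in integrable (lebesgue_on {t\<^sub>1..t}) g \<and>
               \<phi> t x y - \<phi> t\<^sub>1 x\<^sub>1 y\<^sub>1 = integral\<^sup>L (lebesgue_on {t\<^sub>1..t}) g))"
    using \<phi> unfolding test_function_def by (elim conjE)
  have t00: "t\<^sub>0 \<in> {t\<^sub>0..<T}" using t0 by simp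
  have past: "\<forall>r\<in>{0..t\<^sub>0}. x r = x\<^sub>0 r \<and> y r = y\<^sub>0 r" using xp yp by simp
  have G: "integrable (lebesgue_on {t\<^sub>0..t}) G"
    "\<phi> t x y - \<phi> t\<^sub>0 x\<^sub>0 y\<^sub>0 = integral\<^sup>L (lebesgue_on {t\<^sub>0..t}) G"
    using chain[rule_format, OF t00 x0 y0 xp(1) yp(1) X' Y' past[rule_format] xXyY t]
    unfolding G_def Let_def by auto
  have "AE s in lebesgue_on {t\<^sub>0..T}.
        (x s \<in> range (blinfun_apply emb) \<longrightarrow> \<phi>x s x y \<in> range (blinfun_apply emb)) \<and>
        (y s \<in> range (blinfun_apply emb) \<longrightarrow> \<phi>y s x y \<in> range (blinfun_apply emb))"
    using \<phi> xp yp unfolding test_function_def by blast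
  with eqX eqY xX yY have "AE s in lebesgue_on {t\<^sub>0..T}. G s - ?P s = k s"
  proof eventually_elim
    case (elim s)
    then have "\<phi>x s x y \<in> range (blinfun_apply emb)" "\<phi>y s x y \<in> range (blinfun_apply emb)"
      by auto
    moreover have "X' s = H_to_dual emb (f s) - A s (X s)" "Y' s = H_to_dual emb (g s) - A s (Y s)"
      using elim by (auto simp: eq_diff_eq)
    ultimately show ?case
      unfolding G_def k_def by (simp add: dual_pairing_H_to_dual_diff)
  qed
  then have ae: "AE s in lebesgue_on {t\<^sub>0..t}. G s - ?P s = k s"
    by (rule AE_lebesgue_on_subset) (use t in auto)
  have int: "integrable (lebesgue_on {t\<^sub>0..t}) (\<lambda>s. G s - ?P s)"
    using G(1) P by (rule Bochner_Integration.integrable_diff)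
  show "integrable (lebesgue_on {t\<^sub>0..t}) k"
    using integrable_lebesgue_on_AE(1)[OF _ int ae] by simp
  show "integral\<^sup>L (lebesgue_on {t\<^sub>0..t}) k = \<phi> t x y - \<phi> t\<^sub>0 x\<^sub>0 y\<^sub>0
      - integral\<^sup>L (lebesgue_on {t\<^sub>0..t}) ?P"
    using integrable_lebesgue_on_AE(2)[OF _ int ae] G(2) Bochner_Integration.integral_diff[OF G(1) P] by simp
qed

lemma touches_from_aboveD:
  assumes "touches_from_above emb A T p q L \<Omega> w t\<^sub>0 x\<^sub>0 y\<^sub>0 \<phi>"
  shows "\<exists>T\<^sub>0\<in>{t\<^sub>0<..T}. \<phi> t\<^sub>0 x\<^sub>0 y\<^sub>0 = w t\<^sub>0 x\<^sub>0 y\<^sub>0 \<and>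
    (\<forall>t\<in>{t\<^sub>0..T\<^sub>0}. \<forall>x\<in>trajectories emb A T p q L t\<^sub>0 x\<^sub>0 \<inter> \<Omega>.
      \<forall>y\<in>trajectories emb A T p q L t\<^sub>0 y\<^sub>0 \<inter> \<Omega>. w t x y \<le> \<phi> t x y)"
proof -
  obtain T\<^sub>0 where T0: "T\<^sub>0 \<in> {t\<^sub>0<..T}" "\<phi> t\<^sub>0 x\<^sub>0 y\<^sub>0 - w t\<^sub>0 x\<^sub>0 y\<^sub>0 = 0"
    and inf: "(INF (t, x, y) \<in> {t\<^sub>0..T\<^sub>0} \<times> (trajectories emb A T p q L t\<^sub>0 x\<^sub>0 \<inter> \<Omega>)
      \<times> (trajectories emb A T p q L t\<^sub>0 y\<^sub>0 \<inter> \<Omega>). ereal (\<phi> t x y - w t x y)) = 0"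
    using assms unfolding touches_from_above_def by blast
  have "w t x y \<le> \<phi> t x y" if "t \<in> {t\<^sub>0..T\<^sub>0}" "x \<in> trajectories emb A T p q L t\<^sub>0 x\<^sub>0 \<inter> \<Omega>"
      "y \<in> trajectories emb A T p q L t\<^sub>0 y\<^sub>0 \<inter> \<Omega>" for t x y
  proof -
    have "0 \<le> (\<lambda>(t, x, y). ereal (\<phi> t x y - w t x y)) (t, x, y)"
      unfolding inf[symmetric] by (rule INF_lower) (use that in auto)
    then show ?thesis by simp
  qed
  with T0 show ?thesis by (intro bexI[of _ T\<^sub>0]) auto
qed

text \<open>The whole argument for one contact point and one pair of trajectories along which the minimax
  inequalities hold for the directions \<open>\<zeta> = \<partial>\<^sub>x\<phi>\<close> and \<open>\<eta> = -\<partial>\<^sub>y\<phi>\<close> at that point.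
  With these directions the unknown right-hand sides \<open>f\<close> and \<open>g\<close> enter the comparison of \<open>\<phi>\<close>
  with \<open>u - v\<close> only through \<open>f \<bullet> (\<partial>\<^sub>x\<phi> - \<zeta>)\<close> and \<open>g \<bullet> (\<partial>\<^sub>y\<phi> + \<eta>)\<close>, which tend to 0
  because \<open>f\<close> and \<open>g\<close> are bounded.\<close>

lemma contact_inequality:
  fixes emb :: "'v::banach \<Rightarrow>\<^sub>L 'h::{real_inner,complete_space}"
  assumes \<phi>: "test_function emb T p q t\<^sub>0 \<phi> \<phi>t \<phi>x \<phi>y"
    and F: "\<And>z. cont_wrt (d_inf T) ({t\<^sub>0..T} \<times> paths T) (\<lambda>(t, x). F t x z)"
    and x: "trajectory emb A T p q L t\<^sub>0 x\<^sub>0 x X f" and y: "trajectory emb A T p q L t\<^sub>0 y\<^sub>0 y Y g"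
    and x0: "x\<^sub>0 \<in> paths T" and y0: "y\<^sub>0 \<in> paths T"
    and t0: "0 \<le> t\<^sub>0" "t\<^sub>0 < T\<^sub>0" "T\<^sub>0 \<le> T" and L: "0 \<le> L"
    and \<zeta>: "\<zeta> = \<phi>x t\<^sub>0 x\<^sub>0 y\<^sub>0" and \<eta>: "\<eta> = - \<phi>y t\<^sub>0 x\<^sub>0 y\<^sub>0"
    and u: "\<And>t. t \<in> {t\<^sub>0..T\<^sub>0} \<Longrightarrow> u t\<^sub>0 x\<^sub>0 \<le>
           integral\<^sup>L (lebesgue_on {t\<^sub>0..t}) (\<lambda>s. (- f s) \<bullet> \<zeta> + F s x \<zeta>) + u t x"
    and v: "\<And>t. t \<in> {t\<^sub>0..T\<^sub>0} \<Longrightarrow> v t\<^sub>0 y\<^sub>0 \<ge>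
           integral\<^sup>L (lebesgue_on {t\<^sub>0..t}) (\<lambda>s. (- g s) \<bullet> \<eta> + F s y \<eta>) + v t y"
    and contact: "\<phi> t\<^sub>0 x\<^sub>0 y\<^sub>0 = u t\<^sub>0 x\<^sub>0 - v t\<^sub>0 y\<^sub>0"
    and above: "\<And>t. t \<in> {t\<^sub>0..T\<^sub>0} \<Longrightarrow> u t x - v t y \<le> \<phi> t x y"
  defines "k \<equiv> \<lambda>s. - dual_pairing emb (A s (X s)) (\<phi>x s x y)
                  - dual_pairing emb (A s (Y s)) (\<phi>y s x y)"
  shows "integrable (lebesgue_on {t\<^sub>0..T}) k"
    and "ereal (- \<phi>t t\<^sub>0 x\<^sub>0 y\<^sub>0 - F t\<^sub>0 x\<^sub>0 \<zeta> + F t\<^sub>0 y\<^sub>0 \<eta>) \<le> Limsup (at_right 0)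
      (\<lambda>\<delta>. ereal (1 / \<delta> * integral\<^sup>L (lebesgue_on {t\<^sub>0..t\<^sub>0 + \<delta>}) k))"
proof -
  have t0T: "t\<^sub>0 < T" "t\<^sub>0 \<in> {t\<^sub>0..T}" using t0 by auto
  have xp: "x \<in> paths T" "\<And>r. r \<in> {0..t\<^sub>0} \<Longrightarrow> x r = x\<^sub>0 r"
    and yp: "y \<in> paths T" "\<And>r. r \<in> {0..t\<^sub>0} \<Longrightarrow> y r = y\<^sub>0 r"
    using x y unfolding trajectory_def by blast+
  have \<phi>': "cont_wrt (d_inf2 T) ({t\<^sub>0..T} \<times> paths T \<times> paths T) (\<lambda>(t, x, y). \<phi>t t x y)"
    "cont_wrt (d_inf2 T) ({t\<^sub>0..T} \<times> paths T \<times> paths T) (\<lambda>(t, x, y). \<phi>x t x y)"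
    "cont_wrt (d_inf2 T) ({t\<^sub>0..T} \<times> paths T \<times> paths T) (\<lambda>(t, x, y). \<phi>y t x y)"
    using \<phi> unfolding test_function_def by blast+
  have cont: "continuous_on {t\<^sub>0..T} (\<lambda>s. \<phi>t s x y)" "continuous_on {t\<^sub>0..T} (\<lambda>s. \<phi>x s x y)"
    "continuous_on {t\<^sub>0..T} (\<lambda>s. \<phi>y s x y)"
    unfolding continuous_on_def
    using \<phi>'[THEN cont_wrt_d_inf2_tendsto, OF t0(1) _ xp(1) xp(1) yp(1) yp(1)] by auto
  have contF: "continuous_on {t\<^sub>0..T} (\<lambda>s. F s x z)" "continuous_on {t\<^sub>0..T} (\<lambda>s. F s y z)" for z
    unfolding continuous_on_def
    using cont_wrt_d_inf_tendsto[OF F t0(1) _ xp(1) xp(1)]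
      cont_wrt_d_inf_tendsto[OF F t0(1) _ yp(1) yp(1)] by auto
  have lim: "((\<lambda>s. \<phi>t s x y) \<longlongrightarrow> \<phi>t t\<^sub>0 x\<^sub>0 y\<^sub>0) (at t\<^sub>0 within {t\<^sub>0..T})"
    "((\<lambda>s. \<phi>x s x y) \<longlongrightarrow> \<phi>x t\<^sub>0 x\<^sub>0 y\<^sub>0) (at t\<^sub>0 within {t\<^sub>0..T})"
    "((\<lambda>s. \<phi>y s x y) \<longlongrightarrow> \<phi>y t\<^sub>0 x\<^sub>0 y\<^sub>0) (at t\<^sub>0 within {t\<^sub>0..T})"
    using \<phi>'[THEN cont_wrt_d_inf2_tendsto, OF t0(1) t0T(2) xp(1) x0 yp(1) y0 xp(2) yp(2)] by auto
  have limF: "((\<lambda>s. F s x z) \<longlongrightarrow> F t\<^sub>0 x\<^sub>0 z) (at t\<^sub>0 within {t\<^sub>0..T})"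
    "((\<lambda>s. F s y z) \<longlongrightarrow> F t\<^sub>0 y\<^sub>0 z) (at t\<^sub>0 within {t\<^sub>0..T})" for z
    using cont_wrt_d_inf_tendsto[OF F t0(1) t0T(2) xp(1) x0 xp(2)]
      cont_wrt_d_inf_tendsto[OF F t0(1) t0T(2) yp(1) y0 yp(2)] by auto
  obtain M where M: "AE s in lebesgue_on {t\<^sub>0..T}. norm (f s) \<le> M"
    using trajectory_rhs_bounded[OF x t0(1) L] .
  obtain N where N: "AE s in lebesgue_on {t\<^sub>0..T}. norm (g s) \<le> N"
    using trajectory_rhs_bounded[OF y t0(1) L] .
  have int_cont: "integrable (lebesgue_on {t\<^sub>0..t}) c" if "continuous_on {t\<^sub>0..T} c" "t \<in> {t\<^sub>0..T}"
    for c :: "real \<Rightarrow> real" and t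
    using that by (intro continuous_imp_integrable_real) (auto intro: continuous_on_subset)
  note int_f = trajectory_rhs_inner_integrable[OF x t0(1) L]
  note int_g = trajectory_rhs_inner_integrable[OF y t0(1) L]
  let ?P = "\<lambda>s. \<phi>t s x y + f s \<bullet> \<phi>x s x y + g s \<bullet> \<phi>y s x y"
  let ?U = "\<lambda>s. (- f s) \<bullet> \<zeta> + F s x \<zeta>" and ?V = "\<lambda>s. (- g s) \<bullet> \<eta> + F s y \<eta>"
  have P: "integrable (lebesgue_on {t\<^sub>0..t}) ?P" if "t \<in> {t\<^sub>0..T}" for t
    using that cont by (intro Bochner_Integration.integrable_add int_cont int_f int_g) auto
  have U: "integrable (lebesgue_on {t\<^sub>0..t}) ?U" if "t \<in> {t\<^sub>0..T}" for t
  proof -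
    have "integrable (lebesgue_on {t\<^sub>0..t}) (\<lambda>s. - (f s \<bullet> \<zeta>) + F s x \<zeta>)"
      using that contF
      by (intro Bochner_Integration.integrable_add Bochner_Integration.integrable_minus
          int_f int_cont continuous_on_const) auto
    then show ?thesis by simp
  qed
  have V: "integrable (lebesgue_on {t\<^sub>0..t}) ?V" if "t \<in> {t\<^sub>0..T}" for t
  proof -
    have "integrable (lebesgue_on {t\<^sub>0..t}) (\<lambda>s. - (g s \<bullet> \<eta>) + F s y \<eta>)"
      using that contF
      by (intro Bochner_Integration.integrable_add Bochner_Integration.integrable_minus
          int_g int_cont continuous_on_const) auto
    then show ?thesis by simp
  qed
  note chain = test_function_chain_rule[OF \<phi> x y x0 y0 t0(1) t0T(1) _ P, folded k_def]
  show "integrable (lebesgue_on {t\<^sub>0..T}) k"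
    using t0T by (intro chain(1)) auto
  \<comment> \<open>A continuous lower bound of the integrand that results from the comparison, with \<open>f\<close> and \<open>g\<close>
    replaced by their bounds. The two error terms vanish at \<open>t\<^sub>0\<close>.\<close>
  define R where "R s = - \<phi>t s x y - M * norm (\<phi>x s x y - \<zeta>) - N * norm (\<phi>y s x y + \<eta>)
      - F s x \<zeta> + F s y \<eta>" for s
  have contR: "continuous_on {t\<^sub>0..T} R"
    unfolding R_def by (intro continuous_intros cont contF)
  have R: "AE s in lebesgue_on {t\<^sub>0..T}. R s \<le> ?V s - ?U s - ?P s"
    using M N
  proof eventually_elim
    case (elim s)
    have "f s \<bullet> (\<phi>x s x y - \<zeta>) \<le> M * norm (\<phi>x s x y - \<zeta>)"
      using norm_cauchy_schwarz[of "f s" "\<phi>x s x y - \<zeta>"] mult_right_mono[OF elim(1)]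
      by (meson norm_ge_zero order_trans)
    moreover have "g s \<bullet> (\<phi>y s x y + \<eta>) \<le> N * norm (\<phi>y s x y + \<eta>)"
      using norm_cauchy_schwarz[of "g s" "\<phi>y s x y + \<eta>"] mult_right_mono[OF elim(2)]
      by (meson norm_ge_zero order_trans)
    ultimately show ?case
      unfolding R_def by (simp add: inner_simps)
  qed
  show "ereal (- \<phi>t t\<^sub>0 x\<^sub>0 y\<^sub>0 - F t\<^sub>0 x\<^sub>0 \<zeta> + F t\<^sub>0 y\<^sub>0 \<eta>) \<le> Limsup (at_right 0)
      (\<lambda>\<delta>. ereal (1 / \<delta> * integral\<^sup>L (lebesgue_on {t\<^sub>0..t\<^sub>0 + \<delta>}) k))"
  proof (rule Limsup_average_ge[OF t0(2)])
    have "(R \<longlongrightarrow> - \<phi>t t\<^sub>0 x\<^sub>0 y\<^sub>0 - M * norm (\<phi>x t\<^sub>0 x\<^sub>0 y\<^sub>0 - \<zeta>) - N * norm (\<phi>y t\<^sub>0 x\<^sub>0 y\<^sub>0 + \<eta>)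
      - F t\<^sub>0 x\<^sub>0 \<zeta> + F t\<^sub>0 y\<^sub>0 \<eta>) (at t\<^sub>0 within {t\<^sub>0..T})"
      unfolding R_def by (intro tendsto_intros lim limF)
    then show "(R \<longlongrightarrow> - \<phi>t t\<^sub>0 x\<^sub>0 y\<^sub>0 - F t\<^sub>0 x\<^sub>0 \<zeta> + F t\<^sub>0 y\<^sub>0 \<eta>) (at t\<^sub>0 within {t\<^sub>0..T\<^sub>0})"
      unfolding \<zeta> \<eta> by (rule tendsto_within_subset[THEN tendsto_eq_rhs]) (use t0 in auto)
  next
    fix t assume t: "t \<in> {t\<^sub>0..T\<^sub>0}"
    with t0 have tT: "t \<in> {t\<^sub>0..T}" by auto
    show intR: "integrable (lebesgue_on {t\<^sub>0..t}) R"
      using contR tT by (rule int_cont)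
    have int: "integrable (lebesgue_on {t\<^sub>0..t}) (\<lambda>s. ?V s - ?U s - ?P s)"
      by (intro Bochner_Integration.integrable_diff P U V tT)
    have "integral\<^sup>L (lebesgue_on {t\<^sub>0..t}) R
        \<le> integral\<^sup>L (lebesgue_on {t\<^sub>0..t}) (\<lambda>s. ?V s - ?U s - ?P s)"
      using intR int
    proof (rule integral_mono_AE)
      show "AE s in lebesgue_on {t\<^sub>0..t}. R s \<le> ?V s - ?U s - ?P s"
        using R by (rule AE_lebesgue_on_subset) (use tT in auto)
    qed
    also have "\<dots> = integral\<^sup>L (lebesgue_on {t\<^sub>0..t}) ?V - integral\<^sup>L (lebesgue_on {t\<^sub>0..t}) ?U
        - integral\<^sup>L (lebesgue_on {t\<^sub>0..t}) ?P"
      using Bochner_Integration.integral_diff[OF Bochner_Integration.integrable_diff[OF V[OF tT] U[OF tT]] P[OF tT]]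
        Bochner_Integration.integral_diff[OF V[OF tT] U[OF tT]] by simp
    also have "\<dots> \<le> \<phi> t x y - \<phi> t\<^sub>0 x\<^sub>0 y\<^sub>0 - integral\<^sup>L (lebesgue_on {t\<^sub>0..t}) ?P"
      using u[OF t] v[OF t] contact above[OF t] by linarith
    also have "\<dots> = integral\<^sup>L (lebesgue_on {t\<^sub>0..t}) k"
      using chain(2)[OF tT tT] by simp
    finally show "integral\<^sup>L (lebesgue_on {t\<^sub>0..t}) R \<le> integral\<^sup>L (lebesgue_on {t\<^sub>0..t}) k" .
  qed
qed

lemma hamiltonian_cont_wrt:
  fixes F :: "real \<Rightarrow> (real \<Rightarrow> 'h::{real_inner,complete_space}) \<Rightarrow> 'h \<Rightarrow> real"
  assumes "hamiltonian_assms emb A T p q F" "0 \<le> t\<^sub>0"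
  shows "cont_wrt (d_inf T) ({t\<^sub>0..T} \<times> paths T) (\<lambda>(t, x). F t x z)"
  unfolding cont_wrt_def
proof (intro ballI allI impI)
  fix a :: "real \<times> (real \<Rightarrow> 'h)" and e :: real assume a: "a \<in> {t\<^sub>0..T} \<times> paths T" and e: "e > 0"
  obtain t x where tx: "a = (t, x)" by (cases a)
  have F: "cont_wrt (\<lambda>(t, x, z) (s, y, z'). d_inf T (t, x) (s, y) + norm (z - z'))
       ({0..T} \<times> paths T \<times> UNIV) (\<lambda>(t, x, z). F t x z)"
    using assms(1) unfolding hamiltonian_assms_def by blast
  have "(t, x, z) \<in> {0..T} \<times> paths T \<times> UNIV" using a tx assms(2) by auto
  then obtain \<delta> where "\<delta> > 0" and \<delta>: "\<And>b. b \<in> {0..T} \<times> paths T \<times> UNIV \<Longrightarrow>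
      (\<lambda>(t, x, z) (s, y, z'). d_inf T (t, x) (s, y) + norm (z - z')) (t, x, z) b < \<delta> \<Longrightarrow>
      dist ((\<lambda>(t, x, z). F t x z) b) ((\<lambda>(t, x, z). F t x z) (t, x, z)) < e"
    using F e unfolding cont_wrt_def by meson
  have "dist (F s y z) (F t x z) < e" if "s \<in> {t\<^sub>0..T}" "y \<in> paths T" "d_inf T (t, x) (s, y) < \<delta>"
    for s y
    using \<delta>[of "(s, y, z)"] that assms(2) by auto
  then show "\<exists>\<delta>>0. \<forall>b\<in>{t\<^sub>0..T} \<times> paths T. d_inf T a b < \<delta> \<longrightarrow>
      dist (case b of (t, x) \<Rightarrow> F t x z) (case a of (t, x) \<Rightarrow> F t x z) < e"
    unfolding tx using \<open>\<delta> > 0\<close> by (intro exI[of _ \<delta>]) auto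
qed

theorem theorem4p3:
  fixes emb :: "'v::banach \<Rightarrow>\<^sub>L 'h::{real_inner,complete_space}"
    and A :: "real \<Rightarrow> 'v \<Rightarrow> ('v \<Rightarrow>\<^sub>L real)"
    and T p q L :: real
    and F :: "real \<Rightarrow> (real \<Rightarrow> 'h) \<Rightarrow> 'h \<Rightarrow> real"
    and h :: "(real \<Rightarrow> 'h) \<Rightarrow> real"
    and xstar :: 'h
    and \<Omega> :: "(real \<Rightarrow> 'h) set"
    and u v :: "real \<Rightarrow> (real \<Rightarrow> 'h) \<Rightarrow> real"
  assumes "T > 0" and "p \<ge> 2" and "q > 1" and "1 / p + 1 / q = 1"
    and "gelfand_embedding emb"
    and "operator_assms T p q A"
    and "cont_wrt (sup_dist T) (paths T) h"
    and "hamiltonian_assms emb A T p q F"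
    and "L \<ge> 0"
    and "trajectories emb A T p q L 0 (const_path T xstar) \<subseteq> \<Omega>" and "\<Omega> \<subseteq> paths T"
    and "minimax_subsolution emb A T p q F h L \<Omega> u"
    and "minimax_supersolution emb A T p q F h L \<Omega> v"
  shows "viscosity_subsolution_doubled emb A T p q F L \<Omega> (\<lambda>t x y. u t x - v t y)"
proof -
  have u: "usc_wrt (d_inf T) ({0..T} \<times> \<Omega>) (\<lambda>(t, x). u t x)"
    "\<forall>t\<^sub>0\<in>{0..<T}. \<forall>x\<^sub>0\<in>\<Omega>. \<forall>z. \<exists>x\<in>\<Omega>. \<exists>X f. trajectory emb A T p q L t\<^sub>0 x\<^sub>0 x X f \<and>
        (\<forall>t\<in>{t\<^sub>0..T}. u t\<^sub>0 x\<^sub>0 \<le>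
           integral\<^sup>L (lebesgue_on {t\<^sub>0..t}) (\<lambda>s. (- f s) \<bullet> z + F s x z) + u t x)"
    using assms(12) unfolding minimax_subsolution_def by auto
  have v: "lsc_wrt (d_inf T) ({0..T} \<times> \<Omega>) (\<lambda>(t, x). v t x)"
    "\<forall>t\<^sub>0\<in>{0..<T}. \<forall>x\<^sub>0\<in>\<Omega>. \<forall>z. \<exists>x\<in>\<Omega>. \<exists>X f. trajectory emb A T p q L t\<^sub>0 x\<^sub>0 x X f \<and>
        (\<forall>t\<in>{t\<^sub>0..T}. v t\<^sub>0 x\<^sub>0 \<ge>
           integral\<^sup>L (lebesgue_on {t\<^sub>0..t}) (\<lambda>s. (- f s) \<bullet> z + F s x z) + v t x)"
    using assms(13) unfolding minimax_supersolution_def by auto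
  show ?thesis
    unfolding viscosity_subsolution_doubled_def
  proof (intro conjI ballI allI impI)
    show "usc_wrt (d_inf2 T) ({0..T} \<times> \<Omega> \<times> \<Omega>) (\<lambda>(t, x, y). u t x - v t y)"
      using u(1) v(1) \<open>\<Omega> \<subseteq> paths T\<close> by (rule usc_wrt_diff)
  next
    fix t\<^sub>0 x\<^sub>0 y\<^sub>0 \<phi> \<phi>t \<phi>x \<phi>y
    assume t0: "t\<^sub>0 \<in> {0..<T}" and x0: "x\<^sub>0 \<in> \<Omega>" and y0: "y\<^sub>0 \<in> \<Omega>"
      and \<phi>: "test_function emb T p q t\<^sub>0 \<phi> \<phi>t \<phi>x \<phi>y"
      and touch: "touches_from_above emb A T p q L \<Omega> (\<lambda>t x y. u t x - v t y) t\<^sub>0 x\<^sub>0 y\<^sub>0 \<phi>"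
    define \<zeta> where "\<zeta> = \<phi>x t\<^sub>0 x\<^sub>0 y\<^sub>0"
    define \<eta> where "\<eta> = - \<phi>y t\<^sub>0 x\<^sub>0 y\<^sub>0"
    obtain x X f where x: "x \<in> \<Omega>" "trajectory emb A T p q L t\<^sub>0 x\<^sub>0 x X f"
      and ux: "\<And>t. t \<in> {t\<^sub>0..T} \<Longrightarrow> u t\<^sub>0 x\<^sub>0 \<le>
           integral\<^sup>L (lebesgue_on {t\<^sub>0..t}) (\<lambda>s. (- f s) \<bullet> \<zeta> + F s x \<zeta>) + u t x"
      using u(2)[rule_format, OF t0 x0, of \<zeta>] by blast
    obtain y Y g where y: "y \<in> \<Omega>" "trajectory emb A T p q L t\<^sub>0 y\<^sub>0 y Y g"
      and vy: "\<And>t. t \<in> {t\<^sub>0..T} \<Longrightarrow> v t\<^sub>0 y\<^sub>0 \<ge>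
           integral\<^sup>L (lebesgue_on {t\<^sub>0..t}) (\<lambda>s. (- g s) \<bullet> \<eta> + F s y \<eta>) + v t y"
      using v(2)[rule_format, OF t0 y0, of \<eta>] by blast
    obtain T\<^sub>0 where T0: "T\<^sub>0 \<in> {t\<^sub>0<..T}" and contact: "\<phi> t\<^sub>0 x\<^sub>0 y\<^sub>0 = u t\<^sub>0 x\<^sub>0 - v t\<^sub>0 y\<^sub>0"
      and above: "\<And>t x y. t \<in> {t\<^sub>0..T\<^sub>0} \<Longrightarrow> x \<in> trajectories emb A T p q L t\<^sub>0 x\<^sub>0 \<inter> \<Omega> \<Longrightarrow>
        y \<in> trajectories emb A T p q L t\<^sub>0 y\<^sub>0 \<inter> \<Omega> \<Longrightarrow> u t x - v t y \<le> \<phi> t x y"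
      using touches_from_aboveD[OF touch] by blast
    have xy: "x \<in> trajectories emb A T p q L t\<^sub>0 x\<^sub>0 \<inter> \<Omega>" "y \<in> trajectories emb A T p q L t\<^sub>0 y\<^sub>0 \<inter> \<Omega>"
      using x y unfolding trajectories_def by auto
    define k where "k = (\<lambda>t. - dual_pairing emb (A t (X t)) (\<phi>x t x y)
                        - dual_pairing emb (A t (Y t)) (\<phi>y t x y))"
    define \<Lambda> where "\<Lambda> = Limsup (at_right 0)
      (\<lambda>\<delta>. ereal (1 / \<delta> * integral\<^sup>L (lebesgue_on {t\<^sub>0..t\<^sub>0 + \<delta>}) k))"
    have paths0: "x\<^sub>0 \<in> paths T" "y\<^sub>0 \<in> paths T" and T0': "0 \<le> t\<^sub>0" "t\<^sub>0 < T\<^sub>0" "T\<^sub>0 \<le> T"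
      using x0 y0 t0 T0 \<open>\<Omega> \<subseteq> paths T\<close> by auto
    have sub: "t \<in> {t\<^sub>0..T}" if "t \<in> {t\<^sub>0..T\<^sub>0}" for t
      using that T0' by auto
    note contact_inequality' = contact_inequality[where \<phi> = \<phi> and \<phi>t = \<phi>t and \<phi>x = \<phi>x and \<phi>y = \<phi>y
        and F = F and u = u and v = v and x\<^sub>0 = x\<^sub>0 and y\<^sub>0 = y\<^sub>0 and \<zeta> = \<zeta> and \<eta> = \<eta>,
        OF \<phi> hamiltonian_cont_wrt[OF assms(8) T0'(1)] x(2) y(2) paths0 T0' \<open>L \<ge> 0\<close> \<zeta>_def \<eta>_def
          ux[OF sub] vy[OF sub] contact above[OF _ xy]]
    have k: "integrable (lebesgue_on {t\<^sub>0..T}) k"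
      unfolding k_def by (rule contact_inequality'(1))
    have \<Lambda>: "ereal (- \<phi>t t\<^sub>0 x\<^sub>0 y\<^sub>0 - F t\<^sub>0 x\<^sub>0 \<zeta> + F t\<^sub>0 y\<^sub>0 \<eta>) \<le> \<Lambda>"
      unfolding k_def \<Lambda>_def by (rule contact_inequality'(2))
    have "ereal (\<phi>t t\<^sub>0 x\<^sub>0 y\<^sub>0) + \<Lambda> + ereal (F t\<^sub>0 x\<^sub>0 \<zeta> - F t\<^sub>0 y\<^sub>0 \<eta>) \<ge> 0"
      using \<Lambda> by (cases \<Lambda>) auto
    with k x(2) y(2)
    show "\<exists>x X f y Y g.
           trajectory emb A T p q L t\<^sub>0 x\<^sub>0 x X f \<and> trajectory emb A T p q L t\<^sub>0 y\<^sub>0 y Y g \<and>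
           (let k = (\<lambda>t. - dual_pairing emb (A t (X t)) (\<phi>x t x y)
                        - dual_pairing emb (A t (Y t)) (\<phi>y t x y))
            in integrable (lebesgue_on {t\<^sub>0..T}) k \<and>
               ereal (\<phi>t t\<^sub>0 x\<^sub>0 y\<^sub>0)
               + Limsup (at_right 0)
                   (\<lambda>\<delta>. ereal (1 / \<delta> * integral\<^sup>L (lebesgue_on {t\<^sub>0..t\<^sub>0 + \<delta>}) k))
               + ereal (F t\<^sub>0 x\<^sub>0 (\<phi>x t\<^sub>0 x\<^sub>0 y\<^sub>0) - F t\<^sub>0 y\<^sub>0 (- \<phi>y t\<^sub>0 x\<^sub>0 y\<^sub>0)) \<ge> 0)"
      unfolding Let_def \<zeta>_def \<eta>_def \<Lambda>_def k_def by blast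
  qed
qed

end
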